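(* Let $(\mathcal{X},\mathcal{F},m)$ be a probability space with $\mathcal{X}$ Polish, and let $(\mathcal{E},\mathbb{D})$ be a conservative, local (diffusion type) Dirichlet form on $L^2(\mathcal{X};m)$ with associated Markov semigroup $(T_t)_{t\ge0}$ and associated Markov process $(X_t)$ with continuous paths, realized on $\Omega=\mathcal{C}([0,1],\mathcal{X})$ with $X_t(\omega)=\omega(t)$ and law $\mathbb{P}$ (initial distribution $m$). Let $\Delta=\{0=t_0<t_1<\dots<t_n=1\}$ be a partition of $[0,1]$ and $A_0,A_1,\dots,A_n$ measurable subsets of $\mathcal{X}$, and let $\mathcal{A}_\Delta=\{\gamma\in\mathcal{C}([0,1],\mathcal{X}) : \gamma(t_i)\in A_i \text{ for } i=0,\dots,n\}$. Then $$\mathbb{P}(X_\cdot\in\mathcal{A}_\Delta)=\int \mathbf 1_{A_0}\,T_{t_1-t_0}\big(\mathbf 1_{A_1}T_{t_2-t_1}(\cdots T_{t_n-t_{n-1}}\mathbf 1_{A_n})\big)\,dm \le \sqrt{m(A_0)}\sqrt{m(A_n)}\exp\Big(-\frac12\sum_{i=0}^{n-1}\frac{d^2(A_i,A_{i+1})}{t_{i+1}-t_i}\Big),$$ where $d$ is the intrinsic metric between sets defined in the context.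
   Context: $\mathbb{D}_b=\mathbb{D}\cap L^\infty(\mathcal{X};m)$. For $f,g,h\in\mathbb{D}_b$ set $I(f,g;h)=\mathcal{E}(gh,f)+\mathcal{E}(fh,g)-\mathcal{E}(fg,h)$ and $I_f(h)=I(f,f;h)$. Let $\mathbb{D}_0=\{f\in\mathbb{D}_b : I_f(h)\le\|h\|_{L^1(m)} \text{ for all } h\in\mathbb{D}_b\}$. For measurable $A,B\subset\mathcal{X}$ the intrinsic distance is $d(A,B)=\sup_{f\in\mathbb{D}_0}\{\operatorname{ess\,inf}_{x\in B}f(x)-\operatorname{ess\,sup}_{y\in A}f(y)\}$, with conventions $\sup\emptyset=-\infty$, $\inf\emptyset=\infty$ (so $d$ may take the value $\infty$, in which case the exponential is $0$). *)

theory Defs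
  imports "HOL-Analysis.Analysis" "HOL-Probability.Probability"
begin

section \<open>Function spaces over (X, borel, m); functions are representatives mod m-a.e.\<close>

definition L2 :: "'a measure \<Rightarrow> ('a \<Rightarrow> real) set" where
  "L2 m = {f. f \<in> borel_measurable m \<and> integrable m (\<lambda>x. (f x)\<^sup>2)}"

definition Linf :: "'a measure \<Rightarrow> ('a \<Rightarrow> real) set" where
  "Linf m = {f. f \<in> borel_measurable m \<and> (\<exists>C. AE x in m. \<bar>f x\<bar> \<le> C)}"

definition E1 :: "'a measure \<Rightarrow> (('a \<Rightarrow> real) \<Rightarrow> ('a \<Rightarrow> real) \<Rightarrow> real) \<Rightarrow> ('a \<Rightarrow> real) \<Rightarrow> real" where
  "E1 m E u = E u u + (\<integral>x. (u x)\<^sup>2 \<partial>m)"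

definition dirichlet_form ::
  "'a measure \<Rightarrow> (('a \<Rightarrow> real) \<Rightarrow> ('a \<Rightarrow> real) \<Rightarrow> real) \<Rightarrow> ('a \<Rightarrow> real) set \<Rightarrow> bool" where
  "dirichlet_form m E D \<longleftrightarrow>
     D \<subseteq> L2 m \<and>
     (\<lambda>_. 0) \<in> D \<and>
     (\<forall>f\<in>D. \<forall>g\<in>D. (\<lambda>x. f x + g x) \<in> D) \<and>
     (\<forall>f\<in>D. \<forall>c::real. (\<lambda>x. c * f x) \<in> D) \<and>
     (\<forall>f\<in>D. \<forall>g\<in>L2 m. (AE x in m. f x = g x) \<longrightarrow> g \<in> D \<and> (\<forall>h\<in>D. E g h = E f h \<and> E h g = E h f)) \<and>
     (\<forall>f\<in>D. \<forall>g\<in>D. E f g = E g f) \<and>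
     (\<forall>f\<in>D. \<forall>g\<in>D. \<forall>h\<in>D. E (\<lambda>x. f x + g x) h = E f h + E g h) \<and>
     (\<forall>f\<in>D. \<forall>g\<in>D. \<forall>c::real. E (\<lambda>x. c * f x) g = c * E f g) \<and>
     (\<forall>f\<in>D. E f f \<ge> 0) \<and>
     (\<forall>f\<in>L2 m. \<forall>\<epsilon>>0. \<exists>g\<in>D. (\<integral>x. (f x - g x)\<^sup>2 \<partial>m) < \<epsilon>) \<and>
     (\<forall>u::nat \<Rightarrow> 'a \<Rightarrow> real. (\<forall>k. u k \<in> D) \<longrightarrow>
        (\<forall>\<epsilon>>0. \<exists>N. \<forall>k\<ge>N. \<forall>l\<ge>N. E1 m E (\<lambda>x. u k x - u l x) < \<epsilon>) \<longrightarrow>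
        (\<exists>f\<in>D. (\<lambda>k. E1 m E (\<lambda>x. u k x - f x)) \<longlonglongrightarrow> 0)) \<and>
     (\<forall>f\<in>D. (\<lambda>x. max 0 (min 1 (f x))) \<in> D \<and>
        E (\<lambda>x. max 0 (min 1 (f x))) (\<lambda>x. max 0 (min 1 (f x))) \<le> E f f)"

definition local_form ::
  "'a measure \<Rightarrow> (('a \<Rightarrow> real) \<Rightarrow> ('a \<Rightarrow> real) \<Rightarrow> real) \<Rightarrow> ('a \<Rightarrow> real) set \<Rightarrow> bool" where
  "local_form m E D \<longleftrightarrow>
     (\<forall>f\<in>D. \<forall>g\<in>D. \<forall>a::real. (AE x in m. (f x + a) * g x = 0) \<longrightarrow> E f g = 0)"

definition markov_semigroup ::
  "'a measure \<Rightarrow> (real \<Rightarrow> ('a \<Rightarrow> real) \<Rightarrow> ('a \<Rightarrow> real)) \<Rightarrow> bool" where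
  "markov_semigroup m T \<longleftrightarrow>
     (\<forall>t\<ge>0. \<forall>f\<in>L2 m. T t f \<in> L2 m) \<and>
     (\<forall>t\<ge>0. \<forall>f\<in>L2 m. \<forall>g\<in>L2 m. (AE x in m. f x = g x) \<longrightarrow> (AE x in m. T t f x = T t g x)) \<and>
     (\<forall>t\<ge>0. \<forall>f\<in>L2 m. \<forall>g\<in>L2 m. \<forall>a b::real.
        AE x in m. T t (\<lambda>y. a * f y + b * g y) x = a * T t f x + b * T t g x) \<and>
     (\<forall>f\<in>L2 m. AE x in m. T 0 f x = f x) \<and>
     (\<forall>s\<ge>0. \<forall>t\<ge>0. \<forall>f\<in>L2 m. AE x in m. T (s + t) f x = T s (T t f) x) \<and>
     (\<forall>t\<ge>0. \<forall>f\<in>L2 m. (\<integral>x. (T t f x)\<^sup>2 \<partial>m) \<le> (\<integral>x. (f x)\<^sup>2 \<partial>m)) \<and>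
     (\<forall>t\<ge>0. \<forall>f\<in>L2 m. \<forall>g\<in>L2 m. (\<integral>x. T t f x * g x \<partial>m) = (\<integral>x. f x * T t g x \<partial>m)) \<and>
     (\<forall>f\<in>L2 m. ((\<lambda>t. \<integral>x. (T t f x - f x)\<^sup>2 \<partial>m) \<longlongrightarrow> 0) (at_right 0)) \<and>
     (\<forall>t\<ge>0. \<forall>f\<in>L2 m. (AE x in m. 0 \<le> f x \<and> f x \<le> 1) \<longrightarrow>
        (AE x in m. 0 \<le> T t f x \<and> T t f x \<le> 1))"

text \<open>T is the semigroup associated with (E, D) (Fukushima, Lemma 1.3.4).\<close>
definition associated_semigroup ::
  "'a measure \<Rightarrow> (('a \<Rightarrow> real) \<Rightarrow> ('a \<Rightarrow> real) \<Rightarrow> real) \<Rightarrow> ('a \<Rightarrow> real) set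
    \<Rightarrow> (real \<Rightarrow> ('a \<Rightarrow> real) \<Rightarrow> ('a \<Rightarrow> real)) \<Rightarrow> bool" where
  "associated_semigroup m E D T \<longleftrightarrow>
     markov_semigroup m T \<and>
     (\<forall>f\<in>L2 m. f \<in> D \<longleftrightarrow>
        (\<exists>L. ((\<lambda>t. (1 / t) * (\<integral>x. (f x - T t f x) * f x \<partial>m)) \<longlongrightarrow> L) (at_right 0))) \<and>
     (\<forall>f\<in>D. \<forall>g\<in>D.
        ((\<lambda>t. (1 / t) * (\<integral>x. (f x - T t f x) * g x \<partial>m)) \<longlongrightarrow> E f g) (at_right 0))"

definition conservative :: "'a measure \<Rightarrow> (real \<Rightarrow> ('a \<Rightarrow> real) \<Rightarrow> ('a \<Rightarrow> real)) \<Rightarrow> bool" where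
  "conservative m T \<longleftrightarrow> (\<forall>t\<ge>0. AE x in m. T t (\<lambda>_. 1) x = 1)"

definition paths :: "(real \<Rightarrow> 'a::topological_space) set" where
  "paths = {\<omega>. continuous_on {0..1} \<omega> \<and> (\<forall>t. t \<notin> {0..1} \<longrightarrow> \<omega> t = undefined)}"

definition path_filtration :: "real \<Rightarrow> (real \<Rightarrow> 'a::topological_space) measure" where
  "path_filtration s = sigma paths
     {{\<omega>\<in>paths. \<omega> r \<in> B} | r B. 0 \<le> r \<and> r \<le> s \<and> B \<in> sets borel}"

definition associated_process ::
  "'a::topological_space measure \<Rightarrow> (real \<Rightarrow> ('a \<Rightarrow> real) \<Rightarrow> ('a \<Rightarrow> real))
     \<Rightarrow> (real \<Rightarrow> 'a) measure \<Rightarrow> bool" where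
  "associated_process m T P \<longleftrightarrow>
     prob_space P \<and> space P = paths \<and> sets P = sets (path_filtration 1) \<and>
     (\<forall>B\<in>sets borel. measure P {\<omega>\<in>paths. \<omega> 0 \<in> B} = measure m B) \<and>
     (\<forall>s t f. 0 \<le> s \<longrightarrow> 0 \<le> t \<longrightarrow> s + t \<le> 1 \<longrightarrow> f \<in> borel_measurable borel \<longrightarrow>
        (\<exists>C. \<forall>x. \<bar>f x\<bar> \<le> C) \<longrightarrow>
        (\<forall>A\<in>sets (path_filtration s).
           (LINT \<omega>:A|P. f (\<omega> (s + t))) = (LINT \<omega>:A|P. T t f (\<omega> s))))"

definition Db :: "'a measure \<Rightarrow> ('a \<Rightarrow> real) set \<Rightarrow> ('a \<Rightarrow> real) set" where
  "Db m D = D \<inter> Linf m"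

definition Ienergy :: "(('a \<Rightarrow> real) \<Rightarrow> ('a \<Rightarrow> real) \<Rightarrow> real)
    \<Rightarrow> ('a \<Rightarrow> real) \<Rightarrow> ('a \<Rightarrow> real) \<Rightarrow> ('a \<Rightarrow> real) \<Rightarrow> real" where
  "Ienergy E f g h = E (\<lambda>x. g x * h x) f + E (\<lambda>x. f x * h x) g - E (\<lambda>x. f x * g x) h"

definition D0 :: "'a measure \<Rightarrow> (('a \<Rightarrow> real) \<Rightarrow> ('a \<Rightarrow> real) \<Rightarrow> real) \<Rightarrow> ('a \<Rightarrow> real) set
    \<Rightarrow> ('a \<Rightarrow> real) set" where
  "D0 m E D = {f\<in>Db m D. \<forall>h\<in>Db m D. Ienergy E f f h \<le> (\<integral>x. \<bar>h x\<bar> \<partial>m)}"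

text \<open>essential sup / inf of f over a set (w.r.t. m); over a null set they are -\<infinity> / \<infinity>.\<close>
definition ess_sup_on :: "'a measure \<Rightarrow> 'a set \<Rightarrow> ('a \<Rightarrow> real) \<Rightarrow> ereal" where
  "ess_sup_on m A f = Inf {z. AE x in m. x \<in> A \<longrightarrow> ereal (f x) \<le> z}"

definition ess_inf_on :: "'a measure \<Rightarrow> 'a set \<Rightarrow> ('a \<Rightarrow> real) \<Rightarrow> ereal" where
  "ess_inf_on m B f = Sup {z. AE x in m. x \<in> B \<longrightarrow> z \<le> ereal (f x)}"

definition intrinsic_dist :: "'a measure \<Rightarrow> (('a \<Rightarrow> real) \<Rightarrow> ('a \<Rightarrow> real) \<Rightarrow> real) \<Rightarrow> ('a \<Rightarrow> real) set
    \<Rightarrow> 'a set \<Rightarrow> 'a set \<Rightarrow> ereal" where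
  "intrinsic_dist m E D A B = (SUP f\<in>D0 m E D. ess_inf_on m B f - ess_sup_on m A f)"

primrec nested :: "(real \<Rightarrow> ('a \<Rightarrow> real) \<Rightarrow> ('a \<Rightarrow> real)) \<Rightarrow> (nat \<Rightarrow> real) \<Rightarrow> (nat \<Rightarrow> 'a set)
    \<Rightarrow> nat \<Rightarrow> nat \<Rightarrow> 'a \<Rightarrow> real" where
  "nested T t A n 0 = indicator (A n)"
| "nested T t A n (Suc j) =
     (\<lambda>x. indicator (A (n - Suc j)) x * T (t (n - j) - t (n - Suc j)) (nested T t A n j) x)"

definition exp_neg_half :: "ereal \<Rightarrow> real" where
  "exp_neg_half S = (if S = \<infinity> then 0 else exp (- (1/2) * real_of_ereal S))"

end

theory Submission
  imports Defs
begin

text \<open>Davies' method. It suffices to bound \<open>1\<^sub>A T\<^sub>s 1\<^sub>B\<close> on \<open>L\<^sup>2\<close> by \<open>exp (- d(A,B)\<^sup>2 / (2 s))\<close> and to compose these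
  bounds along the partition. For \<open>f\<close> in \<open>D0\<close> the function
  \<open>\<phi>(s) = \<integral> e\<^bsup>2\<alpha>f\<^esup> (T\<^sub>s v)\<^sup>2 dm\<close> satisfies \<open>\<phi>' = - 2 E(e\<^bsup>2\<alpha>f\<^esup> u, u) \<le> \<alpha>\<^sup>2 \<phi>\<close> with \<open>u = T\<^sub>s v\<close>, and
  optimising in \<open>\<alpha>\<close> gives the Gaussian factor.

  The energy inequality is obtained without energy measures or a chain rule. For bounded functions,
  \<open>2 E(f,g)\<close> is the limit of \<open>(1/t)\<close> times the expectation of
  \<open>(f(X\<^sub>0) - f(X\<^sub>t)) (g(X\<^sub>0) - g(X\<^sub>t))\<close>, and on the level of increments the inequality is
  elementary up to an error \<open>(f(X\<^sub>0) - f(X\<^sub>t))\<^sup>4\<close>. Locality, applied to the positive and negative parts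
  of \<open>f - a\<close> for \<open>a\<close> in a finite grid, shows that jumps of \<open>f\<close> are negligible, so this error is
  \<open>o(t)\<close> in expectation. Membership in the domain is detected by boundedness of the difference
  quotients, which are monotone because \<open>t \<mapsto> \<integral> f T\<^sub>t f dm\<close> is convex.\<close>

section \<open>Monotonicity and convexity on the line\<close>

text \<open>Domain questions reduce to \<open>p(t) = \<integral> f T_t f dm\<close>. Symmetry and
  the semigroup law give \<open>p((s+t)/2) = \<integral> T_(s/2) f T_(t/2) f dm\<close>, so
  \<open>p\<close> is midpoint convex by \<open>2xy \<le> x^2 + y^2\<close>; this takes the place of
  spectral calculus.

  The error is of fourth order for a reason of symmetry. In terms of the twisted values
  \<open>e^(\<alpha>a) u\<close> and \<open>e^(\<alpha>b) v\<close> the exponentials survive only in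
  the mixed term, as \<open>e^z + e^(-z) - 2\<close> with \<open>z = \<alpha>(a - b)\<close>: the
  odd powers cancel, and the \<open>z^2\<close> term is exactly the increment version of
  \<open>I_f\<close>.

  The starting function \<open>v\<close> is built from indicators and need not lie in the domain,
  whereas \<open>T_s v\<close> does for \<open>s > 0\<close>. So \<phi> is differentiated at
  positive times only, from the right, and continuity covers time 0.

  Test functions and semigroup values are fixed only up to null sets, while increments evaluate
  functions at points of a path. Truncated Borel versions are therefore used throughout, and
  stationarity of \<open>m\<close> carries almost everywhere statements to fixed times of the
  path.\<close>

lemma right_derivative_nonpos_imp_le:
  fixes f :: "real \<Rightarrow> real"
  assumes ab: "a \<le> b" and cont: "continuous_on {a..b} f"
    and der: "\<And>x. a < x \<Longrightarrow> x < b \<Longrightarrow> \<exists>d\<le>0. (f has_real_derivative d) (at_right x)"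
  shows "f b \<le> f a"
proof (cases "a = b")
  case False
  with ab have ab: "a < b" by simp
  \<comment> \<open>The tilt by \<eta> leaves room for a zero derivative: at a point of
    \<open>S\<close> to the left of \<open>b\<close> the tilted function still decreases to the
    right, so \<open>S\<close> goes further and its supremum must be \<open>b\<close>.\<close>
  have main: "f b - \<eta> * b \<le> f c - \<eta> * c" if c: "a < c" "c < b" and \<eta>: "\<eta> > 0" for c \<eta>
  proof -
    define S where "S = {x\<in>{c..b}. f x - \<eta> * x \<le> f c - \<eta> * c}"
    have "closed S"
      unfolding S_def
      by (intro continuous_on_closed_Collect_le continuous_intros continuous_on_subset[OF cont])
         (use c in auto)
    moreover have bdd: "bdd_above S" by (auto simp: S_def)
    moreover have ne: "S \<noteq> {}"
    proof -
      have "c \<in> S" using c by (simp add: S_def)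
      then show ?thesis by blast
    qed
    ultimately have SS: "Sup S \<in> S" by (intro closed_contains_Sup)
    show ?thesis
    proof (cases "Sup S = b")
      case True
      then show ?thesis using SS by (simp add: S_def)
    next
      case False
      define s where "s = Sup S"
      have s: "c \<le> s" "s < b" "f s - \<eta> * s \<le> f c - \<eta> * c"
        using SS False by (auto simp: S_def s_def)
      then obtain d where d: "d \<le> 0" "(f has_real_derivative d) (at_right s)"
        using der[of s] c by auto
      then have "((\<lambda>y. (f y - f s) / (y - s)) \<longlongrightarrow> d) (at_right s)"
        by (simp add: has_field_derivative_iff)
      then have "\<forall>\<^sub>F y in at_right s. (f y - f s) / (y - s) < \<eta>"
        using d \<eta> by (intro order_tendstoD(2)[of _ d]) auto
      moreover have "\<forall>\<^sub>F y in at_right s. y \<in> {s<..<b}"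
        using s by (intro eventually_at_right_real)
      ultimately have "\<forall>\<^sub>F y in at_right s. (f y - f s) / (y - s) < \<eta> \<and> y \<in> {s<..<b}"
        by eventually_elim auto
      then obtain y where y: "(f y - f s) / (y - s) < \<eta>" "s < y" "y < b"
        by (metis (no_types, lifting) eventually_happens greaterThanLessThan_iff
            trivial_limit_at_right_real)
      then have "f y - f s < \<eta> * (y - s)" by (simp add: field_simps)
      then have "y \<in> S" using y s by (auto simp: S_def algebra_simps)
      then have "y \<le> s" unfolding s_def using bdd by (rule cSup_upper)
      with y show ?thesis by simp
    qed
  qed
  have main': "f b \<le> f c" if c: "a < c" "c < b" for c
  proof (rule field_le_epsilon)
    fix e :: real assume e: "e > 0"
    have "f b \<le> f c + e / (b - c) * (b - c)"
      using main[OF c, of "e / (b - c)"] e c by (simp add: right_diff_distrib)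
    then show "f b \<le> f c + e" using c by simp
  qed
  \<comment> \<open>No derivative is assumed at \<open>a\<close> itself; continuity carries the
    bound there.\<close>
  have "(f \<longlongrightarrow> f a) (at_right a)"
    using cont ab by (auto simp: continuous_on_Icc_at_rightD)
  moreover have "\<forall>\<^sub>F c in at_right a. f b \<le> f c"
    using eventually_at_right_real[OF ab] by eventually_elim (auto intro: main')
  ultimately show ?thesis by (intro tendsto_lowerbound) auto
qed auto

text \<open>Maximum principle at the leftmost maximum \<open>s\<close>. If \<open>s\<close> is
  interior, the symmetric pair \<open>s - r\<close>, \<open>s + r\<close> forces
  \<open>g (s - r)\<close> to be maximal too, against the choice of \<open>s\<close>.\<close>

lemma midpoint_convex_nonpos:
  fixes g :: "real \<Rightarrow> real"
  assumes cont: "continuous_on {a..b} g"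
    and mid: "\<And>x y. x \<in> {a..b} \<Longrightarrow> y \<in> {a..b} \<Longrightarrow> g ((x + y) / 2) \<le> (g x + g y) / 2"
    and ends: "g a \<le> 0" "g b \<le> 0" and x: "x \<in> {a..b}"
  shows "g x \<le> 0"
proof -
  obtain z where z: "z \<in> {a..b}" "\<And>y. y \<in> {a..b} \<Longrightarrow> g y \<le> g z"
    using continuous_attains_sup[of "{a..b}" g] cont x by auto
  define S where "S = {y\<in>{a..b}. g z \<le> g y}"
  have "closed S"
    unfolding S_def by (intro continuous_on_closed_Collect_le continuous_intros cont)
  moreover have bdd: "bdd_below S" by (auto simp: S_def)
  moreover have "S \<noteq> {}" using z by (auto simp: S_def)
  ultimately have SS: "Inf S \<in> S" by (intro closed_contains_Inf)
  define s where "s = Inf S"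
  have s: "s \<in> {a..b}" "g s = g z" using SS z(2)[of s] by (auto simp: S_def s_def)
  show ?thesis
  proof (cases "s = a \<or> s = b")
    case True
    then show ?thesis using z(2)[OF x] s ends by auto
  next
    case False
    define r where "r = min (s - a) (b - s)"
    have r: "r > 0" "s - r \<in> {a..b}" "s + r \<in> {a..b}" using False s by (auto simp: r_def)
    have "g s \<le> (g (s - r) + g (s + r)) / 2" using mid[OF r(2,3)] by simp
    with z(2)[OF r(3)] s have "g z \<le> g (s - r)" by simp
    then have "s - r \<in> S" using r by (simp add: S_def)
    then have "s \<le> s - r" unfolding s_def using bdd by (rule cInf_lower)
    with r show ?thesis by simp
  qed
qed

text \<open>Subtracting the chord gives a midpoint convex function that vanishes at both ends, to
  which the maximum principle applies.\<close>

lemma midpoint_convex_imp_convex_on: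
  fixes g :: "real \<Rightarrow> real"
  assumes I: "convex I" and cont: "continuous_on I g"
    and mid: "\<And>x y. x \<in> I \<Longrightarrow> y \<in> I \<Longrightarrow> g ((x + y) / 2) \<le> (g x + g y) / 2"
  shows "convex_on I g"
proof (rule convex_on_linorderI[OF _ I])
  fix s x y :: real
  assume s: "0 < s" "s < 1" and xy: "x \<in> I" "y \<in> I" "x < y"
  define k where "k = (g y - g x) / (y - x)"
  have sub: "{x..y} \<subseteq> I"
    using xy I by (metis closed_segment_eq_real_ivl closed_segment_subset less_imp_le)
  let ?z = "(1 - s) *\<^sub>R x + s *\<^sub>R y"
  have ky: "k * (y - x) = g y - g x" using xy by (simp add: k_def)
  have z: "?z = x + s * (y - x)" by (simp add: algebra_simps)
  have "s * (y - x) \<le> 1 * (y - x)" using s xy by (intro mult_right_mono) auto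
  moreover have "0 \<le> s * (y - x)" using s xy by auto
  ultimately have zi: "?z \<in> {x..y}" unfolding z by auto
  have "g ?z - g x - k * (?z - x) \<le> 0"
  proof (rule midpoint_convex_nonpos[OF _ _ _ _ zi])
    show "continuous_on {x..y} (\<lambda>z. g z - g x - k * (z - x))"
      by (intro continuous_intros continuous_on_subset[OF cont] sub)
    show "g ((u + v) / 2) - g x - k * ((u + v) / 2 - x)
      \<le> (g u - g x - k * (u - x) + (g v - g x - k * (v - x))) / 2"
      if "u \<in> {x..y}" "v \<in> {x..y}" for u v
    proof -
      have "g ((u + v) / 2) \<le> (g u + g v) / 2" using mid that sub by blast
      moreover have "k * ((u + v) / 2 - x) = (k * (u - x) + k * (v - x)) / 2"
        by (simp add: field_simps)
      ultimately show ?thesis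
        by (simp add: diff_divide_distrib add_divide_distrib)
    qed
    show "g y - g x - k * (y - x) \<le> 0" using ky by simp
  qed simp
  also have "k * (?z - x) = s * (k * (y - x))" unfolding z by (simp add: algebra_simps)
  finally have "g ?z - g x - s * (g y - g x) \<le> 0" unfolding ky .
  then show "g ?z \<le> (1 - s) * g x + s * g y" by (simp add: algebra_simps)
qed

section \<open>Symmetric Markov semigroups\<close>

lemma L2D: "f \<in> L2 m \<Longrightarrow> f \<in> borel_measurable m" "f \<in> L2 m \<Longrightarrow> integrable m (\<lambda>x. (f x)\<^sup>2)"
  by (auto simp: L2_def)

lemma L2_mult_integrable:
  assumes f: "f \<in> L2 m" and g: "g \<in> L2 m"
  shows "integrable m (\<lambda>x. f x * g x)"
proof (rule Bochner_Integration.integrable_bound)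
  show "integrable m (\<lambda>x. (f x)\<^sup>2 + (g x)\<^sup>2)" using f g by (auto simp: L2_def)
  show "(\<lambda>x. f x * g x) \<in> borel_measurable m" using f g by (auto simp: L2_def)
  have "\<bar>a * b\<bar> \<le> a\<^sup>2 + b\<^sup>2" for a b :: real
  proof -
    have "2 * (\<bar>a\<bar> * \<bar>b\<bar>) \<le> a\<^sup>2 + b\<^sup>2"
      using sum_squares_bound[of "\<bar>a\<bar>" "\<bar>b\<bar>"] by (simp add: ac_simps)
    moreover have "0 \<le> \<bar>a\<bar> * \<bar>b\<bar>" by simp
    ultimately show ?thesis unfolding abs_mult by linarith
  qed
  then show "AE x in m. norm (f x * g x) \<le> norm ((f x)\<^sup>2 + (g x)\<^sup>2)" by auto
qed

lemma L2_lincomb: 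
  assumes f: "f \<in> L2 m" and g: "g \<in> L2 m"
  shows "(\<lambda>x. a * f x + b * g x) \<in> L2 m"
proof -
  have "(\<lambda>x. (a * f x + b * g x)\<^sup>2) = (\<lambda>x. a\<^sup>2 * (f x)\<^sup>2 + b\<^sup>2 * (g x)\<^sup>2 + (2 * a * b) * (f x * g x))"
    by (auto simp: power2_eq_square algebra_simps)
  moreover have "integrable m \<dots>"
    using L2D[OF f] L2D[OF g] L2_mult_integrable[OF f g] by auto
  ultimately show ?thesis using f g by (auto simp: L2_def)
qed

lemma L2_diff: "f \<in> L2 m \<Longrightarrow> g \<in> L2 m \<Longrightarrow> (\<lambda>x. f x - g x) \<in> L2 m"
  using L2_lincomb[of f m g 1 "-1"] by simp

lemma L2_add: "f \<in> L2 m \<Longrightarrow> g \<in> L2 m \<Longrightarrow> (\<lambda>x. f x + g x) \<in> L2 m"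
  using L2_lincomb[of f m g 1 1] by simp

lemma L2_Cauchy_Schwarz:
  assumes f: "f \<in> L2 m" and g: "g \<in> L2 m"
  shows "(\<integral>x. f x * g x \<partial>m)\<^sup>2 \<le> (\<integral>x. (f x)\<^sup>2 \<partial>m) * (\<integral>x. (g x)\<^sup>2 \<partial>m)"
proof -
  define a c b where "a = (\<integral>x. (f x)\<^sup>2 \<partial>m)" "c = (\<integral>x. (g x)\<^sup>2 \<partial>m)" "b = (\<integral>x. f x * g x \<partial>m)"
  have q: "0 \<le> a - 2 * l * b + l\<^sup>2 * c" for l
  proof -
    have "0 \<le> (\<integral>x. (f x - l * g x)\<^sup>2 \<partial>m)" by simp
    also have "\<dots> = (\<integral>x. (f x)\<^sup>2 - 2 * l * (f x * g x) + l\<^sup>2 * (g x)\<^sup>2 \<partial>m)"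
      by (intro Bochner_Integration.integral_cong) (auto simp: power2_eq_square algebra_simps)
    also have "\<dots> = a - 2 * l * b + l\<^sup>2 * c"
      using L2D[OF f] L2D[OF g] L2_mult_integrable[OF f g] by (simp add: a_c_b_def)
    finally show ?thesis .
  qed
  have "c \<ge> 0" by (simp add: a_c_b_def)
  then consider "c > 0" | "c = 0" by linarith
  then have "b\<^sup>2 \<le> a * c"
  proof cases
    case 1
    have "0 \<le> (a - 2 * (b / c) * b + (b / c)\<^sup>2 * c) * c" using q[of "b / c"] 1 by simp
    also have "\<dots> = a * c - b\<^sup>2" using 1 by (simp add: field_simps power2_eq_square)
    finally show ?thesis by simp
  next
    case 2
    have "b = 0"
    proof (rule ccontr)
      assume "b \<noteq> 0"
      \<comment> \<open>For \<open>c = 0\<close> the quadratic degenerates to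
        \<open>a - 2lb\<close>, and this \<open>l\<close> gives it the value -1.\<close>
      then show False using q[of "(a + 1) / (2 * b)"] 2 by (simp add: field_simps)
    qed
    then show ?thesis using 2 by simp
  qed
  then show ?thesis by (simp add: a_c_b_def)
qed

lemma L2_abs: "f \<in> L2 m \<Longrightarrow> (\<lambda>x. \<bar>f x\<bar>) \<in> L2 m"
  by (auto simp: L2_def)

lemma (in finite_measure) bounded_in_L2:
  assumes f: "f \<in> borel_measurable M" and bd: "AE x in M. \<bar>f x\<bar> \<le> C"
  shows "f \<in> L2 M"
proof -
  have "integrable M (\<lambda>x. (f x)\<^sup>2)"
  proof (rule integrable_const_bound[where B = "C\<^sup>2"])
    show "AE x in M. norm ((f x)\<^sup>2) \<le> C\<^sup>2"
      using bd by eventually_elim (use abs_le_square_iff in fastforce)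
  qed (use f in auto)
  then show ?thesis using f by (simp add: L2_def)
qed

lemma integrable_bounded_mult:
  fixes G k :: "'a \<Rightarrow> real"
  assumes G: "G \<in> borel_measurable M" "\<And>x. \<bar>G x\<bar> \<le> C" and k: "integrable M k"
  shows "integrable M (\<lambda>x. G x * k x)"
proof (rule Bochner_Integration.integrable_bound)
  show "integrable M (\<lambda>x. C * k x)" using k by simp
  show "(\<lambda>x. G x * k x) \<in> borel_measurable M" using G k by auto
  have "C \<ge> 0" using G(2)[of undefined] abs_ge_zero order_trans by blast
  then show "AE x in M. norm (G x * k x) \<le> norm (C * k x)"
    using G(2) by (intro AE_I2) (simp add: abs_mult mult_right_mono)
qed

section \<open>Strong continuity and convexity for a symmetric Markov semigroup\<close>

locale symmetric_markov_semigroup = prob_space m for m :: "'a measure" +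
  fixes T :: "real \<Rightarrow> ('a \<Rightarrow> real) \<Rightarrow> ('a \<Rightarrow> real)"
  assumes semigroup: "markov_semigroup m T"
begin

lemma T_L2: "t \<ge> 0 \<Longrightarrow> f \<in> L2 m \<Longrightarrow> T t f \<in> L2 m"
  and T_cong: "t \<ge> 0 \<Longrightarrow> f \<in> L2 m \<Longrightarrow> g \<in> L2 m \<Longrightarrow> (AE x in m. f x = g x) \<Longrightarrow>
     (AE x in m. T t f x = T t g x)"
  and T_lin: "t \<ge> 0 \<Longrightarrow> f \<in> L2 m \<Longrightarrow> g \<in> L2 m \<Longrightarrow>
     AE x in m. T t (\<lambda>y. a * f y + b * g y) x = a * T t f x + b * T t g x"
  and T_0: "f \<in> L2 m \<Longrightarrow> AE x in m. T 0 f x = f x"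
  and T_add: "s \<ge> 0 \<Longrightarrow> t \<ge> 0 \<Longrightarrow> f \<in> L2 m \<Longrightarrow> AE x in m. T (s + t) f x = T s (T t f) x"
  and T_contract: "t \<ge> 0 \<Longrightarrow> f \<in> L2 m \<Longrightarrow> (\<integral>x. (T t f x)\<^sup>2 \<partial>m) \<le> (\<integral>x. (f x)\<^sup>2 \<partial>m)"
  and T_sym: "t \<ge> 0 \<Longrightarrow> f \<in> L2 m \<Longrightarrow> g \<in> L2 m \<Longrightarrow>
     (\<integral>x. T t f x * g x \<partial>m) = (\<integral>x. f x * T t g x \<partial>m)"
  and T_cont0: "f \<in> L2 m \<Longrightarrow> ((\<lambda>t. \<integral>x. (T t f x - f x)\<^sup>2 \<partial>m) \<longlongrightarrow> 0) (at_right 0)"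
  and T_unit: "t \<ge> 0 \<Longrightarrow> f \<in> L2 m \<Longrightarrow> (AE x in m. 0 \<le> f x \<and> f x \<le> 1) \<Longrightarrow>
        (AE x in m. 0 \<le> T t f x \<and> T t f x \<le> 1)"
  using semigroup unfolding markov_semigroup_def by (auto simp del: One_nat_def)

text \<open>Contractivity carries strong continuity from time 0 to time \<open>s\<close>, with a
  modulus that does not depend on \<open>s\<close>.\<close>

lemma T_diff_le:
  assumes s: "s \<ge> 0" and r: "r \<ge> 0" and f: "f \<in> L2 m"
  shows "(\<integral>x. (T (s + r) f x - T s f x)\<^sup>2 \<partial>m) \<le> (\<integral>x. (T r f x - f x)\<^sup>2 \<partial>m)"
proof -
  have Tr: "T r f \<in> L2 m" using r f by (rule T_L2)
  have "AE x in m. T s (\<lambda>y. 1 * T r f y + (-1) * f y) x = 1 * T s (T r f) x + (-1) * T s f x"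
    by (rule T_lin[OF s Tr f])
  moreover have "AE x in m. T (s + r) f x = T s (T r f) x" by (rule T_add[OF s r f])
  ultimately have "AE x in m. T s (\<lambda>y. T r f y - f y) x = T (s + r) f x - T s f x"
    by eventually_elim auto
  then have "(\<integral>x. (T (s + r) f x - T s f x)\<^sup>2 \<partial>m) = (\<integral>x. (T s (\<lambda>y. T r f y - f y) x)\<^sup>2 \<partial>m)"
    using L2D(1)[OF T_L2[OF _ f]] L2D(1)[OF T_L2[OF s L2_diff[OF Tr f]]] s r
    by (intro integral_cong_AE) auto
  also have "\<dots> \<le> (\<integral>x. (T r f x - f x)\<^sup>2 \<partial>m)"
    by (rule T_contract[OF s L2_diff[OF Tr f]])
  finally show ?thesis .
qed

text \<open>A difference of squares and Cauchy-Schwarz bound the oscillation by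
  \<open>\<rho> (t - s)\<close>. The weight \<open>G\<close> is 1 for the convexity of
  \<open>\<integral> f T_t f dm\<close> and \<open>e^(2\<alpha>f)\<close> for the Davies
  functional.\<close>

lemma continuous_weighted_norm:
  assumes f: "f \<in> L2 m" and G: "G \<in> borel_measurable m" "\<And>x. \<bar>G x\<bar> \<le> C"
  shows "continuous_on {0..} (\<lambda>s. \<integral>x. G x * (T s f x)\<^sup>2 \<partial>m)"
proof -
  define \<rho> where "\<rho> r = (\<integral>x. (T r f x - f x)\<^sup>2 \<partial>m)" for r
  define N where "N = (\<integral>x. (f x)\<^sup>2 \<partial>m)"
  define \<phi> where "\<phi> s = (\<integral>x. G x * (T s f x)\<^sup>2 \<partial>m)" for s
  have C: "C \<ge> 0" using G(2)[of undefined] abs_ge_zero order_trans by blast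
  note G_int = integrable_bounded_mult[OF G]
  have le: "\<bar>\<phi> t - \<phi> s\<bar> \<le> C * sqrt (\<rho> (t - s) * (4 * N))" if st: "0 \<le> s" "s \<le> t" for s t
  proof -
    have L: "T t f \<in> L2 m" "T s f \<in> L2 m" using T_L2 f st by auto
    let ?a = "\<lambda>x. \<bar>T t f x - T s f x\<bar>" and ?b = "\<lambda>x. \<bar>T t f x + T s f x\<bar>"
    have La: "?a \<in> L2 m" "?b \<in> L2 m" using L by (auto intro: L2_abs L2_diff L2_add)
    have "\<phi> t - \<phi> s = (\<integral>x. G x * (T t f x)\<^sup>2 - G x * (T s f x)\<^sup>2 \<partial>m)"
      unfolding \<phi>_def using G_int L2D(2)[OF L(1)] L2D(2)[OF L(2)] by simp
    also have "\<bar>\<dots>\<bar> \<le> (\<integral>x. \<bar>G x * (T t f x)\<^sup>2 - G x * (T s f x)\<^sup>2\<bar> \<partial>m)"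
      by (rule integral_abs_bound)
    also have "\<dots> \<le> (\<integral>x. C * (?a x * ?b x) \<partial>m)"
    proof (rule integral_mono)
      show "integrable m (\<lambda>x. \<bar>G x * (T t f x)\<^sup>2 - G x * (T s f x)\<^sup>2\<bar>)"
        using G_int L2D(2)[OF L(1)] L2D(2)[OF L(2)] by simp
      show "integrable m (\<lambda>x. C * (?a x * ?b x))"
        using L2_mult_integrable[OF La] by simp
      fix x
      have "\<bar>G x * (T t f x)\<^sup>2 - G x * (T s f x)\<^sup>2\<bar> = \<bar>G x\<bar> * (?a x * ?b x)"
        by (simp add: abs_mult[symmetric] power2_eq_square algebra_simps)
      also have "\<dots> \<le> C * (?a x * ?b x)" using G(2) by (intro mult_right_mono) auto
      finally show "\<bar>G x * (T t f x)\<^sup>2 - G x * (T s f x)\<^sup>2\<bar> \<le> C * (?a x * ?b x)" .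
    qed
    also have "\<dots> = C * (\<integral>x. ?a x * ?b x \<partial>m)" by simp
    also have "\<dots> \<le> C * sqrt (\<rho> (t - s) * (4 * N))"
    proof (intro mult_left_mono real_le_rsqrt C)
      have "(\<integral>x. ?a x * ?b x \<partial>m)\<^sup>2 \<le> (\<integral>x. (?a x)\<^sup>2 \<partial>m) * (\<integral>x. (?b x)\<^sup>2 \<partial>m)"
        by (rule L2_Cauchy_Schwarz[OF La])
      also have "\<dots> \<le> \<rho> (t - s) * (4 * N)"
      proof (rule mult_mono)
        show "(\<integral>x. (?a x)\<^sup>2 \<partial>m) \<le> \<rho> (t - s)"
          using T_diff_le[of s "t - s" f] st f by (simp add: \<rho>_def)
        have "(\<integral>x. (?b x)\<^sup>2 \<partial>m) \<le> (\<integral>x. 2 * (T t f x)\<^sup>2 + 2 * (T s f x)\<^sup>2 \<partial>m)"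
        proof (rule integral_mono)
          show "integrable m (\<lambda>x. (?b x)\<^sup>2)" using La by (auto simp: L2_def)
          show "integrable m (\<lambda>x. 2 * (T t f x)\<^sup>2 + 2 * (T s f x)\<^sup>2)"
            using L by (auto simp: L2_def)
          show "(?b x)\<^sup>2 \<le> 2 * (T t f x)\<^sup>2 + 2 * (T s f x)\<^sup>2" for x
            using sum_squares_bound[of "T t f x" "T s f x"] by (simp add: power2_sum)
        qed
        also have "\<dots> = 2 * (\<integral>x. (T t f x)\<^sup>2 \<partial>m) + 2 * (\<integral>x. (T s f x)\<^sup>2 \<partial>m)"
          using L by (auto simp: L2_def)
        also have "\<dots> \<le> 4 * N"
          using T_contract[of t f] T_contract[of s f] st f by (simp add: N_def)
        finally show "(\<integral>x. (?b x)\<^sup>2 \<partial>m) \<le> 4 * N" .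
      qed (auto simp: \<rho>_def)
      finally show "(\<integral>x. ?a x * ?b x \<partial>m)\<^sup>2 \<le> \<rho> (t - s) * (4 * N)" .
    qed
    finally show ?thesis .
  qed
  have \<rho>0: "\<rho> 0 = 0"
  proof -
    have "\<rho> 0 = (\<integral>x. 0 \<partial>m)"
      unfolding \<rho>_def using T_0[OF f] L2D(1)[OF T_L2[OF _ f]] L2D(1)[OF f]
      by (intro integral_cong_AE) auto
    then show ?thesis by simp
  qed
  have "continuous_on {0..} \<phi>"
    unfolding continuous_on_iff
  proof (intro ballI allI impI)
    fix s e :: real
    assume s: "s \<in> {0..}" and e: "e > 0"
    have "((\<lambda>r. C * sqrt (\<rho> r * (4 * N))) \<longlongrightarrow> C * sqrt (0 * (4 * N))) (at_right 0)"
      unfolding \<rho>_def by (intro tendsto_intros T_cont0 f)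
    then have "\<forall>\<^sub>F r in at_right 0. C * sqrt (\<rho> r * (4 * N)) < e"
      using e by (intro order_tendstoD) auto
    then obtain d where d: "d > 0" "\<And>r. 0 < r \<Longrightarrow> r < d \<Longrightarrow> C * sqrt (\<rho> r * (4 * N)) < e"
      by (auto simp: eventually_at_right_field)
    \<comment> \<open>The filter \<open>at_right 0\<close> says nothing about \<open>r = 0\<close>;
      that case is \<open>\<rho>0\<close>.\<close>
    have d': "C * sqrt (\<rho> r * (4 * N)) < e" if "0 \<le> r" "r < d" for r
      using d(2)[of r] that \<rho>0 e by (cases "r = 0") auto
    show "\<exists>d>0. \<forall>s'\<in>{0..}. dist s' s < d \<longrightarrow> dist (\<phi> s') (\<phi> s) < e"
    proof (intro exI[of _ d] conjI ballI impI d)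
      fix s' assume s': "s' \<in> {0..}" "dist s' s < d"
      show "dist (\<phi> s') (\<phi> s) < e"
      proof (cases "s \<le> s'")
        case True
        then show ?thesis using le[of s s'] d'[of "s' - s"] s s' by (auto simp: dist_real_def)
      next
        case False
        then show ?thesis using le[of s' s] d'[of "s - s'"] s s' by (auto simp: dist_real_def)
      qed
    qed
  qed
  then show ?thesis by (simp add: \<phi>_def[abs_def])
qed

lemma inner_T_add:
  assumes s: "s \<ge> 0" and t: "t \<ge> 0" and f: "f \<in> L2 m"
  shows "(\<integral>x. f x * T (s + t) f x \<partial>m) = (\<integral>x. T s f x * T t f x \<partial>m)"
proof -
  have "(\<integral>x. f x * T (s + t) f x \<partial>m) = (\<integral>x. f x * T s (T t f) x \<partial>m)"
    using T_add[OF s t f] L2D(1)[OF f] L2D(1)[OF T_L2[OF _ f]] L2D(1)[OF T_L2[OF s T_L2[OF t f]]] s t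
    by (intro integral_cong_AE) auto
  also have "\<dots> = (\<integral>x. T s f x * T t f x \<partial>m)"
    using T_sym[OF s f T_L2[OF t f]] by simp
  finally show ?thesis .
qed

lemma convex_inner_T:
  assumes f: "f \<in> L2 m"
  shows "convex_on {0..} (\<lambda>t. \<integral>x. f x * T t f x \<partial>m)"
proof (rule midpoint_convex_imp_convex_on)
  \<comment> \<open>\<open>\<integral> f T_t f dm\<close> is the squared norm of
    \<open>T_(t/2) f\<close>, so the weighted continuity result with weight 1 applies after halving
    the time.\<close>
  have "continuous_on {0..} (\<lambda>s. \<integral>x. 1 * (T s f x)\<^sup>2 \<partial>m)"
    by (rule continuous_weighted_norm[OF f, where C = 1]) auto
  then have "continuous_on {0..} (\<lambda>s. \<integral>x. 1 * (T (s / 2) f x)\<^sup>2 \<partial>m)"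
    by (rule continuous_on_compose2) (auto intro!: continuous_intros)
  also have "?this \<longleftrightarrow> continuous_on {0..} (\<lambda>t. \<integral>x. f x * T t f x \<partial>m)"
    using inner_T_add[OF _ _ f]
    by (intro continuous_on_cong refl) (simp add: power2_eq_square, metis divide_nonneg_nonneg field_sum_of_halves zero_le_numeral)
  finally show "continuous_on {0..} (\<lambda>t. \<integral>x. f x * T t f x \<partial>m)" .
  fix s t :: real assume st: "s \<in> {0..}" "t \<in> {0..}"
  have L: "T (s / 2) f \<in> L2 m" "T (t / 2) f \<in> L2 m" using st f by (auto intro: T_L2)
  have "(\<integral>x. f x * T ((s + t) / 2) f x \<partial>m) = (\<integral>x. T (s / 2) f x * T (t / 2) f x \<partial>m)"
    using inner_T_add[of "s / 2" "t / 2"] st f by (simp add: add_divide_distrib)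
  also have "\<dots> \<le> (\<integral>x. ((T (s / 2) f x)\<^sup>2 + (T (t / 2) f x)\<^sup>2) / 2 \<partial>m)"
    using L2_mult_integrable[OF L] L2D(2)[OF L(1)] L2D(2)[OF L(2)]
    by (intro integral_mono) (auto simp: field_simps sum_squares_bound[simplified mult.assoc])
  also have "\<dots> = ((\<integral>x. (T (s / 2) f x)\<^sup>2 \<partial>m) + (\<integral>x. (T (t / 2) f x)\<^sup>2 \<partial>m)) / 2"
    using L2D(2)[OF L(1)] L2D(2)[OF L(2)] by simp
  also have "\<dots> = ((\<integral>x. f x * T s f x \<partial>m) + (\<integral>x. f x * T t f x \<partial>m)) / 2"
    using inner_T_add[of "s / 2" "s / 2" f] inner_T_add[of "t / 2" "t / 2" f] st f
    by (simp add: power2_eq_square)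
  finally show "(\<integral>x. f x * T ((s + t) / 2) f x \<partial>m) \<le> ((\<integral>x. f x * T s f x \<partial>m) + (\<integral>x. f x * T t f x \<partial>m)) / 2" .
qed auto

end

section \<open>Difference quotients of the form and membership in the domain\<close>

locale dirichlet_semigroup = symmetric_markov_semigroup m T
  for m :: "'a measure" and T +
  fixes E :: "('a \<Rightarrow> real) \<Rightarrow> ('a \<Rightarrow> real) \<Rightarrow> real" and D :: "('a \<Rightarrow> real) set"
  assumes form: "dirichlet_form m E D" and assoc: "associated_semigroup m E D T"
begin

abbreviation approx_energy :: "real \<Rightarrow> ('a \<Rightarrow> real) \<Rightarrow> ('a \<Rightarrow> real) \<Rightarrow> real" where
  "approx_energy t f g \<equiv> (1 / t) * (\<integral>x. (f x - T t f x) * g x \<partial>m)"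

lemma D_L2: "f \<in> D \<Longrightarrow> f \<in> L2 m"
  using form by (auto simp: dirichlet_form_def)

lemma D_AE_cong:
  assumes "f \<in> D" "g \<in> L2 m" "AE x in m. f x = g x"
  shows "g \<in> D" "\<And>h. h \<in> D \<Longrightarrow> E g h = E f h" "\<And>h. h \<in> D \<Longrightarrow> E h g = E h f"
  using form assms unfolding dirichlet_form_def by blast+

lemma E_sym: "f \<in> D \<Longrightarrow> g \<in> D \<Longrightarrow> E f g = E g f"
  using form by (auto simp: dirichlet_form_def)

lemma E_nonneg: "f \<in> D \<Longrightarrow> E f f \<ge> 0"
  using form by (auto simp: dirichlet_form_def)

lemma zero_in_D: "(\<lambda>_. 0) \<in> D"
  using form by (auto simp: dirichlet_form_def)

lemma E_scale: "f \<in> D \<Longrightarrow> g \<in> D \<Longrightarrow> E (\<lambda>x. c * f x) g = c * E f g"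
  using form by (auto simp: dirichlet_form_def)

lemma E_zero_left: "g \<in> D \<Longrightarrow> E (\<lambda>_. 0) g = 0"
  using E_scale[OF zero_in_D, of g 0] by simp

lemma approx_energy_tendsto:
  "f \<in> D \<Longrightarrow> g \<in> D \<Longrightarrow> ((\<lambda>t. approx_energy t f g) \<longlongrightarrow> E f g) (at_right 0)"
  using assoc by (auto simp: associated_semigroup_def)

lemma approx_energy_eq:
  assumes f: "f \<in> L2 m" and t: "t \<ge> 0"
  shows "(\<integral>x. (f x - T t f x) * f x \<partial>m) = (\<integral>x. f x * T 0 f x \<partial>m) - (\<integral>x. f x * T t f x \<partial>m)"
proof -
  have "(\<integral>x. f x * T 0 f x \<partial>m) = (\<integral>x. f x * f x \<partial>m)"
    using T_0[OF f] L2D(1)[OF f] L2D(1)[OF T_L2[OF order_refl f]] by (intro integral_cong_AE) auto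
  then show ?thesis
    using L2_mult_integrable[OF f f] L2_mult_integrable[OF T_L2[OF t f] f]
    by (simp add: left_diff_distrib mult.commute[of "T t f _"])
qed

text \<open>The quotient is minus the slope over \<open>[0, t]\<close> of the convex function
  \<open>t \<mapsto> \<integral> f T_t f dm\<close>, and the slopes of chords starting at 0 increase
  with \<open>t\<close>.\<close>

lemma approx_energy_antimono:
  assumes f: "f \<in> L2 m" and st: "0 < s" "s \<le> t"
  shows "approx_energy t f f \<le> approx_energy s f f"
proof -
  define p where "p t = (\<integral>x. f x * T t f x \<partial>m)" for t
  have "convex_on {0..} p" using convex_inner_T[OF f] by (simp add: p_def[abs_def])
  then have "p ((1 - s / t) *\<^sub>R 0 + (s / t) *\<^sub>R t) \<le> (1 - s / t) * p 0 + (s / t) * p t"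
    using st by (intro convex_onD) auto
  then have "(p 0 - p t) * (s / t) \<le> p 0 - p s" using st by (simp add: algebra_simps)
  then have "(p 0 - p t) / t \<le> (p 0 - p s) / s" using st by (simp add: field_simps)
  then show ?thesis using approx_energy_eq[OF f, of s] approx_energy_eq[OF f, of t] st by (simp add: p_def)
qed

text \<open>For an associated semigroup, membership in \<open>D\<close> means that the quotients
  converge as \<open>t\<close> tends to 0. A monotone bounded family does so, the limit being its
  supremum.\<close>

lemma in_D_if_bounded:
  assumes f: "f \<in> L2 m" and le: "\<And>t. 0 < t \<Longrightarrow> t \<le> 1 \<Longrightarrow> approx_energy t f f \<le> C"
  shows "f \<in> D"
proof -
  define q where "q t = approx_energy t f f" for t
  define L where "L = (SUP t\<in>{0<..1}. q t)"
  have bdd: "bdd_above (q ` {0<..1})" using le by (intro bdd_aboveI2[where M = C]) (auto simp: q_def)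
  have "(q \<longlongrightarrow> L) (at_right 0)"
  proof (rule order_tendstoI)
    fix a assume "a < L"
    then obtain s where s: "s \<in> {0<..1}" "a < q s"
      unfolding L_def using bdd by (subst (asm) less_cSUP_iff) auto
    have "\<forall>\<^sub>F t in at_right 0. t \<in> {0<..<s}" using s by (intro eventually_at_right_real) auto
    then show "\<forall>\<^sub>F t in at_right 0. a < q t"
      by eventually_elim (use s approx_energy_antimono[OF f, of _ s] in \<open>force simp: q_def\<close>)
  next
    fix a assume a: "L < a"
    have "\<forall>\<^sub>F t in at_right (0::real). t \<in> {0<..<1}" by (intro eventually_at_right_real) auto
    then show "\<forall>\<^sub>F t in at_right 0. q t < a"
    proof eventually_elim
      case (elim t)
      then have "q t \<le> L" unfolding L_def using bdd by (intro cSUP_upper) auto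
      with a show ?case by simp
    qed
  qed
  then show ?thesis using assoc f unfolding associated_semigroup_def q_def by blast
qed

lemma approx_energy_le_E:
  assumes f: "f \<in> D" and t: "0 < t"
  shows "approx_energy t f f \<le> E f f"
proof (rule tendsto_lowerbound[OF approx_energy_tendsto[OF f f]])
  have "\<forall>\<^sub>F s in at_right 0. s \<in> {0<..<t}" using t by (rule eventually_at_right_real)
  then show "\<forall>\<^sub>F s in at_right 0. approx_energy t f f \<le> approx_energy s f f"
    by eventually_elim (intro approx_energy_antimono D_L2 f, auto)
qed simp

text \<open>The quotient of \<open>T s f\<close> at \<open>r\<close> is minus the slope of
  \<open>p\<close> over \<open>[2s, 2s + r]\<close>. By convexity it is at most minus the slope over
  \<open>[0, 2s]\<close>, a bound free of \<open>r\<close>.\<close>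

lemma T_in_D:
  assumes f: "f \<in> L2 m" and s: "0 < s"
  shows "T s f \<in> D"
proof -
  define p where "p t = (\<integral>x. f x * T t f x \<partial>m)" for t
  have L: "T s f \<in> L2 m" using f s by (auto intro: T_L2)
  have eq: "(\<integral>x. T s f x * T r (T s f) x \<partial>m) = p (2 * s + r)" if r: "r \<ge> 0" for r
  proof -
    have "(\<integral>x. T s f x * T r (T s f) x \<partial>m) = (\<integral>x. T s f x * T (r + s) f x \<partial>m)"
      using T_add[of r s f] r s f L2D(1)[OF T_L2[OF _ f]] L2D(1)[OF T_L2[OF r L]]
      by (intro integral_cong_AE) auto
    also have "\<dots> = p (s + (r + s))" unfolding p_def using r s f by (subst inner_T_add) auto
    finally show ?thesis by (simp add: algebra_simps)
  qed
  show ?thesis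
  proof (rule in_D_if_bounded[OF L])
    fix r :: real assume r: "0 < r" "r \<le> 1"
    have "convex_on {0..} p" using convex_inner_T[OF f] by (simp add: p_def[abs_def])
    then have "p ((1 - 2 * s / (2 * s + r)) *\<^sub>R 0 + (2 * s / (2 * s + r)) *\<^sub>R (2 * s + r))
      \<le> (1 - 2 * s / (2 * s + r)) * p 0 + (2 * s / (2 * s + r)) * p (2 * s + r)"
      using r s by (intro convex_onD) auto
    moreover have "(1 - 2 * s / (2 * s + r)) *\<^sub>R 0 + (2 * s / (2 * s + r)) *\<^sub>R (2 * s + r) = 2 * s"
      using r s by simp
    moreover have "1 - 2 * s / (2 * s + r) = r / (2 * s + r)" using r s by (simp add: field_simps)
    ultimately have "p (2 * s) \<le> (r * p 0 + 2 * s * p (2 * s + r)) / (2 * s + r)"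
      by (simp add: add_divide_distrib)
    then have "(2 * s + r) * p (2 * s) \<le> r * p 0 + 2 * s * p (2 * s + r)"
      using r s by (simp add: pos_le_divide_eq mult.commute)
    then have "(p (2 * s) - p (2 * s + r)) / r \<le> (p 0 - p (2 * s)) / (2 * s)"
      using r s by (simp add: field_simps)
    then show "approx_energy r (T s f) (T s f) \<le> (p 0 - p (2 * s)) / (2 * s)"
      using approx_energy_eq[OF L, of r] eq[of r] eq[of 0] r by simp
  qed
qed

text \<open>The squared norm is the second difference \<open>p(2r) - 2 p(r) + p(0)\<close>. Divided
  by \<open>r\<close> it is twice the energy quotient at \<open>r\<close> minus twice the quotient
  at \<open>2r\<close>, and both quotients tend to \<open>E u u\<close>. It bounds the second-order
  remainder when the Davies functional is differentiated.\<close>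

lemma T_diff_square_over_t_tendsto_0:
  assumes u: "u \<in> D"
  shows "((\<lambda>r. (1 / r) * (\<integral>x. (T r u x - u x)\<^sup>2 \<partial>m)) \<longlongrightarrow> 0) (at_right 0)"
proof -
  have L: "u \<in> L2 m" using u by (rule D_L2)
  have fl: "filterlim (\<lambda>r::real. 2 * r) (at_right 0) (at_right 0)"
    by (rule filterlim_at_withinI) 
       (auto intro!: tendsto_eq_intros simp: eventually_at_filter)
  have "((\<lambda>r. 2 * approx_energy r u u - 2 * approx_energy (2 * r) u u) \<longlongrightarrow> 2 * E u u - 2 * E u u) (at_right 0)"
    by (intro tendsto_intros approx_energy_tendsto u
        filterlim_compose[OF approx_energy_tendsto[OF u u] fl])
  moreover have "\<forall>\<^sub>F r::real in at_right 0. r \<in> {0<..<1}" by (intro eventually_at_right_real) auto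
  then have "\<forall>\<^sub>F r in at_right 0. 2 * approx_energy r u u - 2 * approx_energy (2 * r) u u
      = (1 / r) * (\<integral>x. (T r u x - u x)\<^sup>2 \<partial>m)"
  proof eventually_elim
    case (elim r)
    define p where "p t = (\<integral>x. u x * T t u x \<partial>m)" for t
    have r: "r > 0" using elim by simp
    have Tr: "T r u \<in> L2 m" using r L by (auto intro: T_L2)
    have 2: "(\<integral>x. (T r u x)\<^sup>2 \<partial>m) = p (r + r)"
      unfolding p_def using inner_T_add[of r r u] r L by (simp add: power2_eq_square)
    have 0: "(\<integral>x. (u x)\<^sup>2 \<partial>m) = p 0"
      unfolding p_def power2_eq_square using T_0[OF L] L2D(1)[OF L] L2D(1)[OF T_L2[OF order_refl L]]
      by (intro integral_cong_AE) auto
    have "(\<integral>x. (T r u x - u x)\<^sup>2 \<partial>m) = (\<integral>x. (T r u x)\<^sup>2 - 2 * (u x * T r u x) + (u x)\<^sup>2 \<partial>m)"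
      by (intro Bochner_Integration.integral_cong) (auto simp: power2_eq_square algebra_simps)
    also have "\<dots> = p (2 * r) - 2 * p r + p 0"
      using L2D(2)[OF L] L2D(2)[OF Tr] L2_mult_integrable[OF L Tr] 2 0 by (simp add: p_def)
    finally show ?case
      using approx_energy_eq[OF L, of r] approx_energy_eq[OF L, of "2 * r"] r
      by (simp add: p_def field_simps)
  qed
  ultimately show ?thesis by (simp add: tendsto_cong)
qed

end

section \<open>The form as a limit of expected products of increments\<close>

text \<open>The bound holds at every point, not just almost everywhere: the Markov property of the
  process is stated for such functions, and inequalities between increments are applied path by
  path.\<close>

definition bounded_borel :: "('a::topological_space \<Rightarrow> real) set" where
  "bounded_borel = {f. f \<in> borel_measurable borel \<and> (\<exists>C. \<forall>x. \<bar>f x\<bar> \<le> C)}"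

lemma bounded_borelI: "f \<in> borel_measurable borel \<Longrightarrow> (\<And>x. \<bar>f x\<bar> \<le> C) \<Longrightarrow> f \<in> bounded_borel"
  by (auto simp: bounded_borel_def)

lemma bounded_borel_measurable: "f \<in> bounded_borel \<Longrightarrow> f \<in> borel_measurable borel"
  by (simp add: bounded_borel_def)

lemma bounded_borelE:
  assumes "f \<in> bounded_borel"
  obtains C where "C > 0" "\<And>x. \<bar>f x\<bar> \<le> C"
proof -
  obtain C where "\<And>x. \<bar>f x\<bar> \<le> C" using assms by (auto simp: bounded_borel_def)
  then have "\<bar>f x\<bar> \<le> max C 1" for x by (simp add: le_max_iff_disj)
  then show ?thesis using that[of "max C 1"] by simp
qed

lemma bounded_borel_mult:
  assumes f: "f \<in> bounded_borel" and g: "g \<in> bounded_borel"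
  shows "(\<lambda>x. f x * g x) \<in> bounded_borel"
proof -
  obtain C1 C2 where C: "C1 > 0" "\<And>x. \<bar>f x\<bar> \<le> C1" "C2 > 0" "\<And>x. \<bar>g x\<bar> \<le> C2"
    using f g by (metis bounded_borelE)
  show ?thesis
  proof (rule bounded_borelI[where C = "C1 * C2"])
    show "(\<lambda>x. f x * g x) \<in> borel_measurable borel"
      using f g by (intro borel_measurable_times bounded_borel_measurable)
    show "\<bar>f x * g x\<bar> \<le> C1 * C2" for x
      unfolding abs_mult using C by (intro mult_mono') auto
  qed
qed

lemma bounded_borel_continuous_comp:
  fixes h :: "real \<Rightarrow> real"
  assumes h: "continuous_on UNIV h" and f: "f \<in> bounded_borel"
  shows "(\<lambda>x. h (f x)) \<in> bounded_borel"
proof -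
  obtain C where C: "C > 0" "\<And>x. \<bar>f x\<bar> \<le> C" using f by (elim bounded_borelE) blast
  have "compact (h ` {-C..C})"
    by (intro compact_continuous_image continuous_on_subset[OF h]) auto
  then obtain B where B: "\<And>y. y \<in> {-C..C} \<Longrightarrow> \<bar>h y\<bar> \<le> B"
    by (metis bounded_iff compact_imp_bounded image_eqI real_norm_def)
  show ?thesis
  proof (rule bounded_borelI[where C = B])
    show "(\<lambda>x. h (f x)) \<in> borel_measurable borel"
      using borel_measurable_continuous_onI[OF h] bounded_borel_measurable[OF f] by measurable
    show "\<bar>h (f x)\<bar> \<le> B" for x using B[of "f x"] C(2)[of x] by (simp add: abs_le_iff)
  qed
qed

section \<open>Path space, stationarity and the two-time law\<close>

lemma space_path_filtration: "space (path_filtration s) = paths"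
  unfolding path_filtration_def by (rule space_measure_of) auto

lemma sets_path_filtration:
  "sets (path_filtration s) = sigma_sets paths {{\<omega>\<in>paths. \<omega> r \<in> B} | r B. 0 \<le> r \<and> r \<le> s \<and> B \<in> sets borel}"
  unfolding path_filtration_def by (rule sets_measure_of) auto

lemma path_filtration_mono: "s \<le> s' \<Longrightarrow> sets (path_filtration s) \<subseteq> sets (path_filtration s')"
  unfolding sets_path_filtration by (intro sigma_sets_mono') force

lemma measurable_coordinate:
  assumes "0 \<le> r" "r \<le> s"
  shows "(\<lambda>\<omega>. \<omega> r) \<in> measurable (path_filtration s) borel"
proof (rule measurableI)
  fix B :: "'a set" assume B: "B \<in> sets borel"
  have "(\<lambda>\<omega>. \<omega> r) -` B \<inter> space (path_filtration s) = {\<omega>\<in>paths. \<omega> r \<in> B}"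
    by (auto simp: space_path_filtration)
  also have "\<dots> \<in> sets (path_filtration s)"
    unfolding sets_path_filtration using assms B by (intro sigma_sets.Basic) auto
  finally show "(\<lambda>\<omega>. \<omega> r) -` B \<inter> space (path_filtration s) \<in> sets (path_filtration s)" .
qed auto

locale dirichlet_process = dirichlet_semigroup m T E D
  for m :: "'a::polish_space measure" and T E D +
  fixes P :: "(real \<Rightarrow> 'a) measure"
  assumes sets_m: "sets m = sets borel" and loc: "local_form m E D"
    and conserv: "conservative m T" and process: "associated_process m T P"
begin

sublocale P: prob_space P
  using process by (simp add: associated_process_def)

lemma space_m: "space m = UNIV"
  using sets_eq_imp_space_eq[OF sets_m] by simp

lemma measurable_m_iff: "f \<in> borel_measurable m \<longleftrightarrow> f \<in> borel_measurable borel"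
  using measurable_cong_sets[OF sets_m refl] by blast

lemma space_P: "space P = paths" and sets_P: "sets P = sets (path_filtration 1)"
  using process by (auto simp: associated_process_def)

lemma measurable_coordinate_P: "0 \<le> r \<Longrightarrow> r \<le> 1 \<Longrightarrow> (\<lambda>\<omega>. \<omega> r) \<in> measurable P borel"
  using measurable_coordinate[of r 1] measurable_cong_sets[OF sets_P refl] by blast

lemma path_filtration_sets_P: "s \<le> 1 \<Longrightarrow> A \<in> sets (path_filtration s) \<Longrightarrow> A \<in> sets P"
  using path_filtration_mono[of s 1] by (auto simp: sets_P)

lemma bounded_borel_L2: "f \<in> bounded_borel \<Longrightarrow> f \<in> L2 m"
  by (auto simp: measurable_m_iff bounded_borel_def intro!: bounded_in_L2)

lemma markov_property:
  assumes "0 \<le> s" "0 \<le> t" "s + t \<le> 1" "f \<in> bounded_borel" "A \<in> sets (path_filtration s)"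
  shows "(LINT \<omega>:A|P. f (\<omega> (s + t))) = (LINT \<omega>:A|P. T t f (\<omega> s))"
  using process assms unfolding associated_process_def bounded_borel_def by blast

lemma distr_coordinate_0: "distr P borel (\<lambda>\<omega>. \<omega> 0) = m"
proof (rule measure_eqI)
  fix B assume "B \<in> sets (distr P borel (\<lambda>\<omega>. \<omega> 0))"
  then have B: "B \<in> sets borel" by simp
  have "emeasure (distr P borel (\<lambda>\<omega>. \<omega> 0)) B = emeasure P ((\<lambda>\<omega>. \<omega> 0) -` B \<inter> space P)"
    using B by (intro emeasure_distr measurable_coordinate_P) auto
  also have "(\<lambda>\<omega>. \<omega> 0) -` B \<inter> space P = {\<omega>\<in>paths. \<omega> 0 \<in> B}" by (auto simp: space_P)
  also have "emeasure P \<dots> = emeasure m B"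
    using process B by (simp add: associated_process_def P.emeasure_eq_measure emeasure_eq_measure)
  finally show "emeasure (distr P borel (\<lambda>\<omega>. \<omega> 0)) B = emeasure m B" .
qed (simp add: sets_m)

lemma integral_coordinate_0:
  "f \<in> borel_measurable borel \<Longrightarrow> (\<integral>\<omega>. f (\<omega> 0) \<partial>P) = (\<integral>x. f x \<partial>m)" for f :: "'a \<Rightarrow> real"
  using integral_distr[OF measurable_coordinate_P[of 0], of f] distr_coordinate_0 by simp

lemma indicator_bounded_borel: "B \<in> sets borel \<Longrightarrow> (indicator B :: 'a \<Rightarrow> real) \<in> bounded_borel"
  by (intro bounded_borelI[where C = 1]) (auto simp: indicator_def)

lemma T_measurable: "t \<ge> 0 \<Longrightarrow> f \<in> L2 m \<Longrightarrow> T t f \<in> borel_measurable borel"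
  using L2D(1)[OF T_L2] measurable_m_iff by blast

text \<open>Stationarity: by symmetry and conservativeness
  \<open>\<integral> T_s 1_B dm = \<integral> 1_B T_s 1 dm = m(B)\<close>. It lets
  \<open>m\<close>-null sets be ignored at every fixed time of the path.\<close>

lemma distr_coordinate:
  assumes s: "0 \<le> s" "s \<le> 1"
  shows "distr P borel (\<lambda>\<omega>. \<omega> s) = m"
proof (rule measure_eqI)
  fix B assume "B \<in> sets (distr P borel (\<lambda>\<omega>. \<omega> s))"
  then have B: "B \<in> sets borel" by simp
  have BL: "(indicator B :: 'a \<Rightarrow> real) \<in> L2 m"
    using B by (intro bounded_borel_L2 indicator_bounded_borel)
  have 1: "(\<lambda>_::'a. 1::real) \<in> L2 m" by (intro bounded_borel_L2 bounded_borelI[where C = 1]) auto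
  have meas: "(\<lambda>\<omega>. \<omega> s) -` B \<inter> space P \<in> sets P"
    using measurable_coordinate_P[OF s] B by (rule measurable_sets)
  have "measure P ((\<lambda>\<omega>. \<omega> s) -` B \<inter> space P) = (LINT \<omega>:space P|P. indicator B (\<omega> s))"
  proof -
    have "(LINT \<omega>:space P|P. indicator B (\<omega> s)) = (\<integral>\<omega>. indicator ((\<lambda>\<omega>. \<omega> s) -` B \<inter> space P) \<omega> \<partial>P)"
      unfolding set_lebesgue_integral_def
      by (intro Bochner_Integration.integral_cong) (auto simp: indicator_def)
    also have "\<dots> = measure P ((\<lambda>\<omega>. \<omega> s) -` B \<inter> space P)" using meas by simp
    finally show ?thesis ..
  qed
  also have "\<dots> = (LINT \<omega>:space P|P. T s (indicator B) (\<omega> 0))"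
    using markov_property[of 0 s "indicator B" "space P"] s B
    by (simp add: indicator_bounded_borel space_P flip: space_path_filtration[of 0])
  also have "\<dots> = (\<integral>\<omega>. T s (indicator B) (\<omega> 0) \<partial>P)"
    by (simp add: set_lebesgue_integral_def cong: Bochner_Integration.integral_cong)
  also have "\<dots> = (\<integral>x. T s (indicator B) x * 1 \<partial>m)"
    using integral_coordinate_0[OF T_measurable[OF s(1) BL]] by simp
  also have "\<dots> = (\<integral>x. indicator B x * T s (\<lambda>_. 1) x \<partial>m)"
    by (rule T_sym[OF s(1) BL 1])
  also have "\<dots> = (\<integral>x. indicator B x \<partial>m)"
    using conserv s L2D(1)[OF BL] L2D(1)[OF T_L2[OF s(1) 1]]
    by (intro integral_cong_AE) (auto simp: conservative_def)
  also have "\<dots> = measure m B" using B by (simp add: space_m)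
  finally show "emeasure (distr P borel (\<lambda>\<omega>. \<omega> s)) B = emeasure m B"
    using B s measurable_coordinate_P[OF s]
    by (simp add: emeasure_distr P.emeasure_eq_measure emeasure_eq_measure)
qed (simp add: sets_m)

lemma integral_coordinate:
  "0 \<le> s \<Longrightarrow> s \<le> 1 \<Longrightarrow> f \<in> borel_measurable borel \<Longrightarrow> (\<integral>\<omega>. f (\<omega> s) \<partial>P) = (\<integral>x. f x \<partial>m)"
  for f :: "'a \<Rightarrow> real"
  using integral_distr[OF measurable_coordinate_P[of s], of f] distr_coordinate[of s] by simp

lemma AE_coordinate:
  assumes s: "0 \<le> s" "s \<le> 1" and "AE x in m. Q x"
  shows "AE \<omega> in P. Q (\<omega> s)"
proof -
  have "AE x in distr P borel (\<lambda>\<omega>. \<omega> s). Q x" 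
    unfolding distr_coordinate[OF s] by fact
  then show ?thesis by (rule AE_distrD[OF measurable_coordinate_P[OF s]])
qed

lemma integrable_coordinate:
  fixes f :: "'a \<Rightarrow> real"
  assumes s: "0 \<le> s" "s \<le> 1" and f: "integrable m f"
  shows "integrable P (\<lambda>\<omega>. f (\<omega> s))"
  using integrable_distr[OF measurable_coordinate_P[OF s], of f] distr_coordinate[OF s] f by simp

lemma L2_integrable: "f \<in> L2 m \<Longrightarrow> integrable m f"
  by (rule square_integrable_imp_integrable) (auto simp: L2_def)

lemma bounded_borel_coordinate_measurable:
  "0 \<le> s \<Longrightarrow> s \<le> 1 \<Longrightarrow> f \<in> bounded_borel \<Longrightarrow> (\<lambda>\<omega>. f (\<omega> s)) \<in> borel_measurable P"
  using measurable_compose[OF measurable_coordinate_P] bounded_borel_measurable by blast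

lemma integrable_P_bounded:
  fixes f :: "(real \<Rightarrow> 'a) \<Rightarrow> real"
  assumes "f \<in> borel_measurable P" "\<And>\<omega>. \<bar>f \<omega>\<bar> \<le> C"
  shows "integrable P f"
  using assms by (intro P.integrable_const_bound[where B = C]) auto

text \<open>The Markov property is given on events of the past only. It identifies
  \<open>T t f\<close> at the starting point as a conditional expectation, which may then be
  multiplied by a function of that point.\<close>

lemma integral_coordinates_product:
  assumes t: "0 \<le> t" "t \<le> 1" and f: "f \<in> bounded_borel" and g: "g \<in> bounded_borel"
  shows "(\<integral>\<omega>. g (\<omega> 0) * f (\<omega> t) \<partial>P) = (\<integral>x. T t f x * g x \<partial>m)"
proof -
  have sub: "subalgebra P (path_filtration 0)"
    unfolding subalgebra_def using path_filtration_mono[of 0 1]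
    by (simp add: sets_P space_P space_path_filtration)
  interpret F: finite_measure_subalgebra P "path_filtration 0"
    by unfold_locales (rule sub)
  obtain Cf Cg where C: "\<And>x. \<bar>f x\<bar> \<le> Cf" "\<And>x. \<bar>g x\<bar> \<le> Cg" "Cf > 0" "Cg > 0"
    using f g by (metis bounded_borelE)
  have mf: "(\<lambda>\<omega>. f (\<omega> t)) \<in> borel_measurable P" and mg: "(\<lambda>\<omega>. g (\<omega> 0)) \<in> borel_measurable P"
    using bounded_borel_coordinate_measurable t f g by auto
  have ft: "integrable P (\<lambda>\<omega>. f (\<omega> t))" using mf C by (intro integrable_P_bounded) auto
  have fL: "f \<in> L2 m" by (rule bounded_borel_L2[OF f])
  have "AE \<omega> in P. real_cond_exp P (path_filtration 0) (\<lambda>\<omega>. f (\<omega> t)) \<omega> = T t f (\<omega> 0)"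
  proof (rule F.real_cond_exp_charact)
    fix A assume A: "A \<in> sets (path_filtration 0 :: (real \<Rightarrow> 'a) measure)"
    show "(LINT \<omega>:A|P. f (\<omega> t)) = (LINT \<omega>:A|P. T t f (\<omega> 0))"
      using markov_property[of 0 t f A] t f A by simp
  next
    show "integrable P (\<lambda>\<omega>. T t f (\<omega> 0))"
      by (intro integrable_coordinate L2_integrable T_L2 t fL) auto
    show "(\<lambda>\<omega>. T t f (\<omega> 0)) \<in> borel_measurable (path_filtration 0)"
      using measurable_compose[OF measurable_coordinate[of 0 0] T_measurable[OF t(1) fL]] by simp
  qed (rule ft)
  then have "(\<integral>\<omega>. g (\<omega> 0) * T t f (\<omega> 0) \<partial>P)
     = (\<integral>\<omega>. g (\<omega> 0) * real_cond_exp P (path_filtration 0) (\<lambda>\<omega>. f (\<omega> t)) \<omega> \<partial>P)"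
    using mg measurable_compose[OF measurable_coordinate_P[of 0] T_measurable[OF t(1) fL]]
    by (intro integral_cong_AE) auto
  also have "\<dots> = (\<integral>\<omega>. g (\<omega> 0) * f (\<omega> t) \<partial>P)"
  proof (rule F.real_cond_exp_intg(2))
    show "integrable P (\<lambda>\<omega>. g (\<omega> 0) * f (\<omega> t))"
      by (rule integrable_P_bounded[where C = "Cg * Cf"])
         (use mf mg C in \<open>auto simp: abs_mult intro!: mult_mono'\<close>)
    show "(\<lambda>\<omega>. g (\<omega> 0)) \<in> borel_measurable (path_filtration 0)"
      using measurable_compose[OF measurable_coordinate[of 0 0] bounded_borel_measurable[OF g]] by simp
  qed (rule mf)
  finally show ?thesis
    using integral_coordinate_0[of "\<lambda>x. g x * T t f x"] T_measurable[OF t(1) fL]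
      bounded_borel_measurable[OF g]
    by (simp add: mult.commute)
qed

section \<open>Expected increments and stability of the bounded domain\<close>

abbreviation increment_form :: "real \<Rightarrow> ('a \<Rightarrow> real) \<Rightarrow> ('a \<Rightarrow> real) \<Rightarrow> real" where
  "increment_form t f g \<equiv> (\<integral>\<omega>. (f (\<omega> 0) - f (\<omega> t)) * (g (\<omega> 0) - g (\<omega> t)) \<partial>P)"

lemma integrable_products:
  assumes t: "0 \<le> t" "t \<le> 1" "0 \<le> s" "s \<le> 1" and f: "f \<in> bounded_borel" and g: "g \<in> bounded_borel"
  shows "integrable P (\<lambda>\<omega>. f (\<omega> s) * g (\<omega> t))"
proof -
  obtain Cf Cg where C: "\<And>x. \<bar>f x\<bar> \<le> Cf" "\<And>x. \<bar>g x\<bar> \<le> Cg" "Cf > 0" "Cg > 0"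
    using f g by (metis bounded_borelE)
  show ?thesis
    by (rule integrable_P_bounded[where C = "Cf * Cg"])
       (use bounded_borel_coordinate_measurable t f g C in \<open>auto simp: abs_mult intro!: mult_mono'\<close>)
qed

lemma integrable_increment:
  assumes t: "0 \<le> t" "t \<le> 1" and f: "f \<in> bounded_borel" and g: "g \<in> bounded_borel"
  shows "integrable P (\<lambda>\<omega>. (f (\<omega> 0) - f (\<omega> t)) * (g (\<omega> 0) - g (\<omega> t)))"
  unfolding left_diff_distrib right_diff_distrib
  by (intro Bochner_Integration.integrable_diff integrable_products t f g) auto

text \<open>Expanding the product gives four terms: by stationarity the two equal-time ones are both
  \<open>\<integral> f g dm\<close>, and by symmetry of \<open>T t\<close> the two cross terms
  agree. Hence the factor 2.\<close>

lemma increment_form_eq: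
  assumes t: "0 \<le> t" "t \<le> 1" and f: "f \<in> bounded_borel" and g: "g \<in> bounded_borel"
  shows "increment_form t f g = 2 * (\<integral>x. (f x - T t f x) * g x \<partial>m)"
proof -
  note L = bounded_borel_L2[OF f] bounded_borel_L2[OF g]
  note i = integrable_products[OF _ _ _ _ f g] integrable_products[OF _ _ _ _ g f]
  have eq: "increment_form t f g = (\<integral>\<omega>. f (\<omega> 0) * g (\<omega> 0) + f (\<omega> t) * g (\<omega> t)
     - f (\<omega> 0) * g (\<omega> t) - g (\<omega> 0) * f (\<omega> t) \<partial>P)"
    by (intro Bochner_Integration.integral_cong) (auto simp: algebra_simps)
  also have "\<dots> = (\<integral>\<omega>. f (\<omega> 0) * g (\<omega> 0) \<partial>P) + (\<integral>\<omega>. f (\<omega> t) * g (\<omega> t) \<partial>P)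
     - (\<integral>\<omega>. f (\<omega> 0) * g (\<omega> t) \<partial>P) - (\<integral>\<omega>. g (\<omega> 0) * f (\<omega> t) \<partial>P)"
    using t by (simp add: i)
  also have "\<dots> = 2 * (\<integral>x. f x * g x \<partial>m) - (\<integral>x. T t g x * f x \<partial>m) - (\<integral>x. T t f x * g x \<partial>m)"
    using integral_coordinate[of 0 "\<lambda>x. f x * g x"] integral_coordinate[of t "\<lambda>x. f x * g x"] t
      integral_coordinates_product[OF t f g] integral_coordinates_product[OF t g f]
      bounded_borel_measurable[OF f] bounded_borel_measurable[OF g] by simp
  also have "(\<integral>x. T t g x * f x \<partial>m) = (\<integral>x. T t f x * g x \<partial>m)"
    using T_sym[OF t(1) L] by (simp add: mult.commute)
  finally show ?thesis
    using L2_mult_integrable[OF L] L2_mult_integrable[OF T_L2[OF t(1) L(1)] L(2)]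
    by (simp add: left_diff_distrib)
qed

abbreviation "bounded_domain \<equiv> D \<inter> bounded_borel"

lemma increment_form_tendsto:
  assumes f: "f \<in> bounded_domain" and g: "g \<in> bounded_domain"
  shows "((\<lambda>t. increment_form t f g / t) \<longlongrightarrow> 2 * E f g) (at_right 0)"
proof -
  have "((\<lambda>t. 2 * approx_energy t f g) \<longlongrightarrow> 2 * E f g) (at_right 0)"
    using f g by (intro tendsto_intros approx_energy_tendsto) auto
  moreover have "\<forall>\<^sub>F t::real in at_right 0. t \<in> {0<..<1}" by (intro eventually_at_right_real) auto
  then have "\<forall>\<^sub>F t in at_right 0. 2 * approx_energy t f g = increment_form t f g / t"
    by eventually_elim (use f g in \<open>simp add: increment_form_eq\<close>)
  ultimately show ?thesis by (rule Lim_transform_eventually)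
qed

text \<open>A pointwise comparison of squared increments passes to expectations and so bounds the
  energy quotients of \<open>g\<close>. Two comparison functions are allowed so that products are
  covered.\<close>

lemma bounded_domainI:
  assumes g: "g \<in> bounded_borel" and f: "f1 \<in> bounded_domain" "f2 \<in> bounded_domain" and C: "C \<ge> 0"
    and le: "\<And>x y. (g x - g y)\<^sup>2 \<le> C * ((f1 x - f1 y)\<^sup>2 + (f2 x - f2 y)\<^sup>2)"
  shows "g \<in> bounded_domain"
proof -
  have "g \<in> D"
  proof (rule in_D_if_bounded[OF bounded_borel_L2[OF g]])
    fix t :: real assume t: "0 < t" "t \<le> 1"
    have bd: "increment_form t f f / t \<le> 2 * E f f" if "f \<in> bounded_domain" for f
      using approx_energy_le_E[of f t] that t increment_form_eq[of t f f] by (simp add: field_simps)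
    have "increment_form t g g \<le> (\<integral>\<omega>. C * ((f1 (\<omega> 0) - f1 (\<omega> t)) * (f1 (\<omega> 0) - f1 (\<omega> t))
        + (f2 (\<omega> 0) - f2 (\<omega> t)) * (f2 (\<omega> 0) - f2 (\<omega> t))) \<partial>P)"
      using t f g le
      by (intro integral_mono integrable_increment integrable_mult_right Bochner_Integration.integrable_add)
         (auto simp: power2_eq_square)
    also have "\<dots> = C * (increment_form t f1 f1 + increment_form t f2 f2)"
      using t f by (simp add: integrable_increment)
    finally have "increment_form t g g / t \<le> C * (increment_form t f1 f1 / t + increment_form t f2 f2 / t)"
      using t by (simp add: field_simps)
    also have "\<dots> \<le> C * (2 * E f1 f1 + 2 * E f2 f2)"
      by (intro mult_left_mono add_mono bd f C)
    finally show "approx_energy t g g \<le> C * (E f1 f1 + E f2 f2)"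
      using increment_form_eq[of t g g] t g by (simp add: field_simps)
  qed
  with g show ?thesis by simp
qed

lemma bounded_domain_mult:
  assumes f: "f \<in> bounded_domain" and g: "g \<in> bounded_domain"
  shows "(\<lambda>x. f x * g x) \<in> bounded_domain"
proof -
  obtain Cf where Cf: "Cf > 0" "\<And>x. \<bar>f x\<bar> \<le> Cf" using f bounded_borelE by blast
  obtain Cg where Cg: "Cg > 0" "\<And>x. \<bar>g x\<bar> \<le> Cg" using g bounded_borelE by blast
  show ?thesis
  proof (rule bounded_domainI[OF _ f g, where C = "2 * (Cf\<^sup>2 + Cg\<^sup>2)"])
    fix x y
    have "(f x * g x - f y * g y)\<^sup>2 = (f x * (g x - g y) + g y * (f x - f y))\<^sup>2"
      by (simp add: algebra_simps)
    also have "\<dots> \<le> 2 * ((f x)\<^sup>2 * (g x - g y)\<^sup>2 + (g y)\<^sup>2 * (f x - f y)\<^sup>2)"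
      using sum_squares_bound[of "f x * (g x - g y)" "g y * (f x - f y)"]
      by (simp add: power2_sum power_mult_distrib)
    also have "\<dots> \<le> 2 * ((Cf\<^sup>2 + Cg\<^sup>2) * (g x - g y)\<^sup>2 + (Cf\<^sup>2 + Cg\<^sup>2) * (f x - f y)\<^sup>2)"
    proof (intro mult_left_mono add_mono mult_right_mono)
      show "(f x)\<^sup>2 \<le> Cf\<^sup>2 + Cg\<^sup>2" using Cf(1) Cf(2)[of x] abs_le_square_iff[of "f x" Cf] by (smt (verit) zero_le_power2)
      show "(g y)\<^sup>2 \<le> Cf\<^sup>2 + Cg\<^sup>2" using Cg(1) Cg(2)[of y] abs_le_square_iff[of "g y" Cg] by (smt (verit) zero_le_power2)
    qed auto
    finally show "(f x * g x - f y * g y)\<^sup>2 \<le> 2 * (Cf\<^sup>2 + Cg\<^sup>2) * ((f x - f y)\<^sup>2 + (g x - g y)\<^sup>2)"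
      by (simp add: algebra_simps)
  qed (use f g in \<open>auto intro: bounded_borel_mult\<close>)
qed

text \<open>Increments do not see constants, so \<open>\<psi> 0 = 0\<close> is not asked for, and a
  Lipschitz bound on the range of \<open>f\<close> suffices. The exponential needs both
  freedoms.\<close>

lemma bounded_domain_lipschitz_comp:
  fixes \<psi> :: "real \<Rightarrow> real"
  assumes f: "f \<in> bounded_domain" and \<psi>: "continuous_on UNIV \<psi>" and C: "\<And>x. \<bar>f x\<bar> \<le> C"
    and lip: "\<And>a b. \<bar>a\<bar> \<le> C \<Longrightarrow> \<bar>b\<bar> \<le> C \<Longrightarrow> \<bar>\<psi> a - \<psi> b\<bar> \<le> L * \<bar>a - b\<bar>"
  shows "(\<lambda>x. \<psi> (f x)) \<in> bounded_domain"
proof (rule bounded_domainI[OF _ f f, where C = "L\<^sup>2"])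
  show "(\<lambda>x. \<psi> (f x)) \<in> bounded_borel" using f \<psi> by (auto intro: bounded_borel_continuous_comp)
  fix x y
  have "\<bar>\<psi> (f x) - \<psi> (f y)\<bar>\<^sup>2 \<le> (L * \<bar>f x - f y\<bar>)\<^sup>2"
    by (rule power_mono) (auto intro!: lip C)
  then have "(\<psi> (f x) - \<psi> (f y))\<^sup>2 \<le> L\<^sup>2 * (f x - f y)\<^sup>2" by (simp add: power_mult_distrib)
  also have "\<dots> \<le> L\<^sup>2 * ((f x - f y)\<^sup>2 + (f x - f y)\<^sup>2)" by (intro mult_left_mono) auto
  finally show "(\<psi> (f x) - \<psi> (f y))\<^sup>2 \<le> L\<^sup>2 * ((f x - f y)\<^sup>2 + (f x - f y)\<^sup>2)" .
qed auto

end

section \<open>Locality and the twisted energy inequality\<close>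

text \<open>A difference up to \<open>3\<epsilon>\<close> is absorbed by the quadratic term. A
  larger one straddles a grid point \<open>a k\<close> with room \<epsilon> on both sides, where the
  increments of the positive and negative parts of \<open>x - a k\<close> have opposite signs and a
  product of size at least \<open>\<epsilon>^2\<close>. The quadratic term has a small coefficient;
  the grid terms may have a huge one, because locality makes their energy vanish.\<close>

lemma quartic_le_grid:
  fixes M \<epsilon> :: real
  assumes M: "M > 0" and \<epsilon>: "\<epsilon> > 0"
  obtains N :: nat and a :: "nat \<Rightarrow> real" where
    "\<And>x y. \<bar>x\<bar> \<le> M \<Longrightarrow> \<bar>y\<bar> \<le> M \<Longrightarrow> (x - y) ^ 4 \<le> 9 * \<epsilon>\<^sup>2 * (x - y)\<^sup>2 +
       16 * M ^ 4 / \<epsilon>\<^sup>2 * (\<Sum>k<N. - ((max 0 (x - a k) - max 0 (y - a k)) * (max 0 (a k - x) - max 0 (a k - y))))"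
proof
  define a where "a k = - M + real k * \<epsilon>" for k
  define N where "N = nat \<lceil>(2 * M + \<epsilon>) / \<epsilon>\<rceil> + 1"
  let ?c = "\<lambda>x y b :: real. - ((max 0 (x - b) - max 0 (y - b)) * (max 0 (b - x) - max 0 (b - y)))"
  have nonneg: "0 \<le> ?c x y b" for x y b
    by (auto simp: max_def mult_le_0_iff)
  have big: "\<epsilon>\<^sup>2 \<le> (\<Sum>k<N. ?c x y (a k))"
    if xy: "\<bar>x\<bar> \<le> M" "\<bar>y\<bar> \<le> M" "x + 3 * \<epsilon> \<le> y" for x y
  proof -
    \<comment> \<open>\<open>a k\<close> is the first grid point not below
      \<open>x + \<epsilon>\<close>. The mesh is \<epsilon>, so it is at most
      \<open>x + 2\<epsilon>\<close>, which is still \<epsilon> below \<open>y\<close>.\<close>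
    define k where "k = nat \<lceil>(x + \<epsilon> + M) / \<epsilon>\<rceil>"
    have q: "0 \<le> (x + \<epsilon> + M) / \<epsilon>" using xy \<epsilon> by auto
    have "real k = of_int \<lceil>(x + \<epsilon> + M) / \<epsilon>\<rceil>" unfolding k_def using q by (intro of_nat_nat) linarith
    then have "(x + \<epsilon> + M) / \<epsilon> \<le> real k" "real k \<le> (x + \<epsilon> + M) / \<epsilon> + 1" by linarith+
    then have k: "x + \<epsilon> \<le> a k" "a k \<le> x + 2 * \<epsilon>" using \<epsilon> by (auto simp: a_def field_simps)
    have "(x + \<epsilon> + M) / \<epsilon> \<le> (2 * M + \<epsilon>) / \<epsilon>" using xy \<epsilon> by (intro divide_right_mono) auto
    then have "nat \<lceil>(x + \<epsilon> + M) / \<epsilon>\<rceil> \<le> nat \<lceil>(2 * M + \<epsilon>) / \<epsilon>\<rceil>"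
      by (intro nat_mono ceiling_mono)
    then have kN: "k < N" unfolding k_def N_def by linarith
    have "\<epsilon> * \<epsilon> \<le> (y - a k) * (a k - x)" using k xy \<epsilon> by (intro mult_mono) auto
    also have "\<dots> = ?c x y (a k)" using k xy \<epsilon> by (simp add: max_def algebra_simps)
    also have "\<dots> \<le> (\<Sum>k<N. ?c x y (a k))"
      using kN nonneg by (intro member_le_sum) auto
    finally show ?thesis by (simp add: power2_eq_square)
  qed
  have sym: "?c x y b = ?c y x b" for x y b by (simp add: algebra_simps)
  fix x y :: real
  assume xy: "\<bar>x\<bar> \<le> M" "\<bar>y\<bar> \<le> M"
  have S0: "0 \<le> 16 * M ^ 4 / \<epsilon>\<^sup>2 * (\<Sum>k<N. ?c x y (a k))"
    using nonneg M by (intro mult_nonneg_nonneg sum_nonneg) auto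
  have p4: "(x - y) ^ 4 = (x - y)\<^sup>2 * (x - y)\<^sup>2" by (simp add: power_add[symmetric])
  show "(x - y) ^ 4 \<le> 9 * \<epsilon>\<^sup>2 * (x - y)\<^sup>2 + 16 * M ^ 4 / \<epsilon>\<^sup>2 * (\<Sum>k<N. ?c x y (a k))"
  proof (cases "\<bar>x - y\<bar> \<le> 3 * \<epsilon>")
    case True
    have "\<bar>x - y\<bar>\<^sup>2 \<le> (3 * \<epsilon>)\<^sup>2" using True by (rule power_mono) auto
    then have "(x - y)\<^sup>2 * (x - y)\<^sup>2 \<le> 9 * \<epsilon>\<^sup>2 * (x - y)\<^sup>2"
      by (intro mult_right_mono) (auto simp: power_mult_distrib)
    with S0 p4 show ?thesis by linarith
  next
    case False
    then have "\<epsilon>\<^sup>2 \<le> (\<Sum>k<N. ?c x y (a k))"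
    proof (cases "x \<le> y")
      case True
      with False xy show ?thesis by (intro big) auto
    next
      case x: False
      have "(\<Sum>k<N. ?c x y (a k)) = (\<Sum>k<N. ?c y x (a k))" by (intro sum.cong refl sym)
      moreover have "\<epsilon>\<^sup>2 \<le> (\<Sum>k<N. ?c y x (a k))" using False x xy by (intro big) auto
      ultimately show ?thesis by simp
    qed
    then have "16 * M ^ 4 / \<epsilon>\<^sup>2 * \<epsilon>\<^sup>2 \<le> 16 * M ^ 4 / \<epsilon>\<^sup>2 * (\<Sum>k<N. ?c x y (a k))"
      using M by (intro mult_left_mono) auto
    then have "16 * M ^ 4 \<le> 16 * M ^ 4 / \<epsilon>\<^sup>2 * (\<Sum>k<N. ?c x y (a k))" using \<epsilon> by simp
    \<comment> \<open>The crude bound \<open>|x - y| \<le> 2M\<close> is the origin of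
      \<open>16 * M ^ 4\<close>.\<close>
    moreover have "\<bar>x - y\<bar> ^ 4 \<le> (2 * M) ^ 4" using xy by (intro power_mono) auto
    then have "(x - y) ^ 4 \<le> 16 * M ^ 4" by (simp add: power_mult_distrib)
    moreover have "0 \<le> 9 * \<epsilon>\<^sup>2 * (x - y)\<^sup>2" by simp
    ultimately show ?thesis by linarith
  qed
qed

text \<open>The odd Taylor terms cancel, and two remainders with factor \<open>1/4!\<close> add up
  to \<open>1/12\<close>.\<close>

lemma exp_symmetric_remainder:
  fixes z Z :: real
  assumes "\<bar>z\<bar> \<le> Z"
  shows "exp z + exp (- z) - 2 \<le> z\<^sup>2 + exp Z / 12 * z ^ 4"
proof -
  obtain s where s: "\<bar>s\<bar> \<le> \<bar>z\<bar>" "exp z = (\<Sum>k<4. z ^ k / fact k) + exp s / fact 4 * z ^ 4"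
    using Maclaurin_exp_le[of z 4] by auto
  obtain s' where s': "\<bar>s'\<bar> \<le> \<bar>- z\<bar>" "exp (- z) = (\<Sum>k<4. (- z) ^ k / fact k) + exp s' / fact 4 * (- z) ^ 4"
    using Maclaurin_exp_le[of "- z" 4] by auto
  have "exp s / 24 * z ^ 4 \<le> exp Z / 24 * z ^ 4" "exp s' / 24 * z ^ 4 \<le> exp Z / 24 * z ^ 4"
    using s s' assms by (auto intro!: mult_right_mono divide_right_mono)
  moreover have "exp z = 1 + z + z\<^sup>2 / 2 + z ^ 3 / 6 + exp s / 24 * z ^ 4"
    using s(2) by (simp add: fact_numeral eval_nat_numeral)
  moreover have "exp (- z) = 1 - z + z\<^sup>2 / 2 - z ^ 3 / 6 + exp s' / 24 * z ^ 4"
    using s'(2) by (simp add: fact_numeral eval_nat_numeral)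
  ultimately show ?thesis by argo
qed

text \<open>The two sides are the integrands of minus the energy of \<open>(e\<^bsup>2\<alpha>f\<^esup> u, u)\<close> and of the carre du
  champ \<open>I\<^bsub>f\<^esub>(e\<^bsup>2\<alpha>f\<^esup> u\<^sup>2)\<close>; they agree to second order in \<open>a - b\<close>.\<close>

lemma twisted_increment_le:
  fixes a b u v \<alpha> M W :: real
  defines "h \<equiv> (exp (\<alpha> * a) * u)\<^sup>2" and "k \<equiv> (exp (\<alpha> * b) * v)\<^sup>2"
  assumes ab: "\<bar>a\<bar> \<le> M" "\<bar>b\<bar> \<le> M" and W: "h \<le> W" "k \<le> W"
  shows "- ((exp (\<alpha> * a) * exp (\<alpha> * a) * u - exp (\<alpha> * b) * exp (\<alpha> * b) * v) * (u - v))
    \<le> \<alpha>\<^sup>2 / 2 * (2 * ((a * h - b * k) * (a - b)) - (a * a - b * b) * (h - k))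
       + W * exp (\<bar>\<alpha>\<bar> * (2 * M)) / 12 * \<alpha> ^ 4 * (a - b) ^ 4"
proof -
  define p q where "p = exp (\<alpha> * a) * u" and "q = exp (\<alpha> * b) * v"
  define z where "z = \<alpha> * (a - b)"
  define c where "c = exp z + exp (- z) - 2"
  have e: "exp (\<alpha> * a) * exp (- (\<alpha> * b)) = exp z" "exp (\<alpha> * b) * exp (- (\<alpha> * a)) = exp (- z)"
    by (simp_all add: z_def algebra_simps flip: exp_add)
  have uv: "u = exp (- (\<alpha> * a)) * p" "v = exp (- (\<alpha> * b)) * q"
    by (simp_all add: p_def q_def exp_minus field_simps)
  have 1: "exp (\<alpha> * a) * exp (- (\<alpha> * a)) = 1" "exp (\<alpha> * b) * exp (- (\<alpha> * b)) = 1"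
    by (simp_all flip: exp_add)
  \<comment> \<open>In terms of \<open>p\<close> and \<open>q\<close> the exponentials cancel on the
    diagonal and stay only in front of \<open>p * q\<close>. Splitting off \<open>(p - q)^2\<close>
    leaves \<open>c\<close>, which is nonnegative and of second order in \<open>z\<close>.\<close>
  have "(exp (\<alpha> * a) * exp (\<alpha> * a) * u - exp (\<alpha> * b) * exp (\<alpha> * b) * v) * (u - v)
      = (exp (\<alpha> * a) * p - exp (\<alpha> * b) * q) * (exp (- (\<alpha> * a)) * p - exp (- (\<alpha> * b)) * q)"
    unfolding uv[symmetric] by (simp add: p_def q_def algebra_simps)
  also have "\<dots> = (exp (\<alpha> * a) * exp (- (\<alpha> * a))) * p\<^sup>2 + (exp (\<alpha> * b) * exp (- (\<alpha> * b))) * q\<^sup>2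
     - p * q * (exp (\<alpha> * a) * exp (- (\<alpha> * b)) + exp (\<alpha> * b) * exp (- (\<alpha> * a)))"
    by (simp add: power2_eq_square algebra_simps)
  also have "\<dots> = (p - q)\<^sup>2 - p * q * c"
    unfolding e 1 c_def by (simp add: power2_eq_square algebra_simps)
  finally have eq: "- ((exp (\<alpha> * a) * exp (\<alpha> * a) * u - exp (\<alpha> * b) * exp (\<alpha> * b) * v) * (u - v))
      = p * q * c - (p - q)\<^sup>2" by simp
  have c0: "0 \<le> c"
  proof -
    have "0 \<le> (exp (z / 2) - exp (- (z / 2)))\<^sup>2" by simp
    also have "\<dots> = c" by (simp add: c_def power2_eq_square algebra_simps flip: exp_add)
    finally show ?thesis .
  qed
  have hk: "h = p\<^sup>2" "k = q\<^sup>2" by (simp_all add: h_def k_def p_def q_def)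
  have "\<bar>z\<bar> \<le> \<bar>\<alpha>\<bar> * (2 * M)"
    unfolding z_def abs_mult using ab by (intro mult_left_mono) auto
  then have c: "c \<le> z\<^sup>2 + exp (\<bar>\<alpha>\<bar> * (2 * M)) / 12 * z ^ 4"
    unfolding c_def by (rule exp_symmetric_remainder)
  define K where "K = exp (\<bar>\<alpha>\<bar> * (2 * M)) / 12"
  have "p * q \<le> (h + k) / 2" unfolding hk using sum_squares_bound[of p q] by simp
  then have "p * q * c \<le> (h + k) / 2 * c" using c0 by (rule mult_right_mono)
  also have "\<dots> \<le> (h + k) / 2 * (z\<^sup>2 + K * z ^ 4)"
    using c unfolding K_def hk by (intro mult_left_mono) auto
  also have "\<dots> = (h + k) / 2 * z\<^sup>2 + (h + k) / 2 * (K * z ^ 4)" by (simp add: algebra_simps)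
  also have "(h + k) / 2 * (K * z ^ 4) \<le> W * (K * z ^ 4)"
    using W by (intro mult_right_mono) (auto simp: K_def)
  finally have "p * q * c \<le> (h + k) / 2 * z\<^sup>2 + W * (K * z ^ 4)" by simp
  \<comment> \<open>An exact identity, with no error term: the increment version of
    \<open>I_f(h)\<close> factors as \<open>(a - b)^2 (h + k)\<close>.\<close>
  moreover have "(h + k) / 2 * z\<^sup>2 = \<alpha>\<^sup>2 / 2 * (2 * ((a * h - b * k) * (a - b)) - (a * a - b * b) * (h - k))"
    by (simp add: z_def power2_eq_square field_simps)
  moreover have "W * (K * z ^ 4) = W * exp (\<bar>\<alpha>\<bar> * (2 * M)) / 12 * \<alpha> ^ 4 * (a - b) ^ 4"
    by (simp add: K_def z_def power_mult_distrib)
  moreover have "0 \<le> (p - q)\<^sup>2" by simp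
  ultimately show ?thesis unfolding eq by linarith
qed

section \<open>Negligibility of jumps and the twisted energy inequality\<close>

context dirichlet_process
begin

lemma integrable_quartic_increment:
  assumes f: "f \<in> bounded_borel" and t: "0 \<le> t" "t \<le> 1"
  shows "integrable P (\<lambda>\<omega>. (f (\<omega> 0) - f (\<omega> t)) ^ 4)"
proof -
  obtain M where M: "M > 0" "\<And>x. \<bar>f x\<bar> \<le> M" using f bounded_borelE by blast
  show ?thesis
  proof (rule integrable_P_bounded[where C = "(2 * M) ^ 4"])
    show "(\<lambda>\<omega>. (f (\<omega> 0) - f (\<omega> t)) ^ 4) \<in> borel_measurable P"
      using bounded_borel_coordinate_measurable[OF _ _ f] t by auto
    show "\<bar>(f (\<omega> 0) - f (\<omega> t)) ^ 4\<bar> \<le> (2 * M) ^ 4" for \<omega>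
      unfolding power_abs using M(2)[of "\<omega> 0"] M(2)[of "\<omega> t"] by (intro power_mono) auto
  qed
qed

text \<open>Path continuity is expressed here by locality of the form: for each grid level the
  positive and negative parts of \<open>f - a k\<close> have disjoint supports, hence zero mutual
  energy.\<close>

lemma quartic_increment_tendsto_0:
  assumes f: "f \<in> bounded_domain"
  shows "((\<lambda>t. (\<integral>\<omega>. (f (\<omega> 0) - f (\<omega> t)) ^ 4 \<partial>P) / t) \<longlongrightarrow> 0) (at_right 0)"
proof -
  obtain M where M: "M > 0" "\<And>x. \<bar>f x\<bar> \<le> M" using f bounded_borelE by blast
  have fb: "f \<in> bounded_borel" using f by simp
  note int4 = integrable_quartic_increment[OF fb]
  show ?thesis
  proof (rule order_tendstoI)
    fix e :: real assume e: "e < 0"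
    have "\<forall>\<^sub>F t::real in at_right 0. t \<in> {0<..<1}" by (intro eventually_at_right_real) auto
    then show "\<forall>\<^sub>F t in at_right 0. e < (\<integral>\<omega>. (f (\<omega> 0) - f (\<omega> t)) ^ 4 \<partial>P) / t"
      by eventually_elim (rule less_le_trans[OF e], auto intro!: divide_nonneg_nonneg)
  next
    fix e :: real assume e: "0 < e"
    \<comment> \<open>Chosen so that the quadratic term has limit
      \<open>e/2 * E f f / (E f f + 1)\<close>, hence below \<open>e\<close>; the added 1 covers
      \<open>E f f = 0\<close>.\<close>
    define \<epsilon> where "\<epsilon> = sqrt (e / (36 * (E f f + 1)))"
    have Ef: "E f f \<ge> 0" using f by (intro E_nonneg) auto
    have \<epsilon>: "\<epsilon> > 0" unfolding \<epsilon>_def using Ef e by auto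
    have "9 * \<epsilon>\<^sup>2 * (2 * E f f) = e / 2 * (E f f / (E f f + 1))"
      unfolding \<epsilon>_def using Ef e by (simp add: field_simps)
    also have "\<dots> \<le> e / 2 * 1" using Ef e by (intro mult_left_mono) (auto simp: divide_le_eq)
    also have "\<dots> < e" using e by simp
    finally have small: "9 * \<epsilon>\<^sup>2 * (2 * E f f) < e" .
    obtain N :: nat and a where grid:
      "\<And>x y. \<bar>x\<bar> \<le> M \<Longrightarrow> \<bar>y\<bar> \<le> M \<Longrightarrow> (x - y) ^ 4 \<le> 9 * \<epsilon>\<^sup>2 * (x - y)\<^sup>2 +
       16 * M ^ 4 / \<epsilon>\<^sup>2 * (\<Sum>k<N. - ((max 0 (x - a k) - max 0 (y - a k)) * (max 0 (a k - x) - max 0 (a k - y))))"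
      by (rule quartic_le_grid[OF M(1) \<epsilon>]) (rule that)
    define K where "K = 16 * M ^ 4 / \<epsilon>\<^sup>2"
    define pos neg where "pos k x = max 0 (f x - a k)" and "neg k x = max 0 (a k - f x)" for k x
    have pn: "pos k \<in> bounded_domain" "neg k \<in> bounded_domain" for k
    proof -
      show "pos k \<in> bounded_domain" unfolding pos_def
        by (rule bounded_domain_lipschitz_comp[OF f _ M(2), where L = 1 and \<psi> = "\<lambda>y. max 0 (y - a k)"])
           (auto intro!: continuous_intros)
      show "neg k \<in> bounded_domain" unfolding neg_def
        by (rule bounded_domain_lipschitz_comp[OF f _ M(2), where L = 1 and \<psi> = "\<lambda>y. max 0 (a k - y)"])
           (auto intro!: continuous_intros)
    qed
    have E0: "E (pos k) (neg k) = 0" for k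
    proof -
      have "AE x in m. (pos k x + 0) * neg k x = 0" by (auto simp: pos_def neg_def max_def)
      then show ?thesis using loc pn[of k] unfolding local_form_def by blast
    qed
    \<comment> \<open>\<epsilon>, \<open>N\<close> and \<open>K\<close> are fixed before
      \<open>t\<close> tends to 0, so the size of \<open>K\<close> does no harm: it multiplies a
      finite sum whose limit is 0.\<close>
    have "((\<lambda>t. 9 * \<epsilon>\<^sup>2 * (increment_form t f f / t) + K * (\<Sum>k<N. - (increment_form t (pos k) (neg k) / t)))
       \<longlongrightarrow> 9 * \<epsilon>\<^sup>2 * (2 * E f f) + K * (\<Sum>k<N. - (2 * E (pos k) (neg k)))) (at_right 0)"
      by (intro tendsto_intros increment_form_tendsto f pn)
    then have "\<forall>\<^sub>F t in at_right 0. 9 * \<epsilon>\<^sup>2 * (increment_form t f f / t)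
        + K * (\<Sum>k<N. - (increment_form t (pos k) (neg k) / t)) < e"
      by (rule order_tendstoD) (use E0 small in simp)
    moreover have "\<forall>\<^sub>F t::real in at_right 0. t \<in> {0<..<1}" by (intro eventually_at_right_real) auto
    ultimately show "\<forall>\<^sub>F t in at_right 0. (\<integral>\<omega>. (f (\<omega> 0) - f (\<omega> t)) ^ 4 \<partial>P) / t < e"
    proof eventually_elim
      case (elim t)
      then have t: "0 \<le> t" "t \<le> 1" "0 < t" by auto
      let ?I = "\<lambda>f g \<omega>. (f (\<omega> 0) - f (\<omega> t)) * (g (\<omega> 0) - g (\<omega> t)) :: real"
      have i: "integrable P (?I f f)" "integrable P (?I (pos k) (neg k))" for k
        using f pn[of k] by (auto intro!: integrable_increment t)
      have "(\<integral>\<omega>. (f (\<omega> 0) - f (\<omega> t)) ^ 4 \<partial>P)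
         \<le> (\<integral>\<omega>. 9 * \<epsilon>\<^sup>2 * ?I f f \<omega> + K * (\<Sum>k<N. - ?I (pos k) (neg k) \<omega>) \<partial>P)"
      proof (rule integral_mono[OF int4[OF t(1,2)]])
        show "integrable P (\<lambda>\<omega>. 9 * \<epsilon>\<^sup>2 * ?I f f \<omega> + K * (\<Sum>k<N. - ?I (pos k) (neg k) \<omega>))"
          using i by (intro Bochner_Integration.integrable_add integrable_mult_right
              Bochner_Integration.integrable_sum Bochner_Integration.integrable_minus) auto
        show "(f (\<omega> 0) - f (\<omega> t)) ^ 4 \<le> 9 * \<epsilon>\<^sup>2 * ?I f f \<omega> + K * (\<Sum>k<N. - ?I (pos k) (neg k) \<omega>)" for \<omega>
          using grid[OF M(2) M(2), of "\<omega> 0" "\<omega> t"]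
          by (simp add: pos_def neg_def K_def power2_eq_square)
      qed
      also have "\<dots> = 9 * \<epsilon>\<^sup>2 * increment_form t f f + K * (\<Sum>k<N. - increment_form t (pos k) (neg k))"
        using i by (simp add: Bochner_Integration.integral_sum)
      finally have "(\<integral>\<omega>. (f (\<omega> 0) - f (\<omega> t)) ^ 4 \<partial>P) / t
          \<le> (9 * \<epsilon>\<^sup>2 * increment_form t f f + K * (\<Sum>k<N. - increment_form t (pos k) (neg k))) / t"
        using t by (intro divide_right_mono) auto
      also have "\<dots> = 9 * \<epsilon>\<^sup>2 * (increment_form t f f / t)
        + K * (\<Sum>k<N. - (increment_form t (pos k) (neg k) / t))"
        by (simp add: diff_divide_distrib sum_negf flip: sum_divide_distrib)
      also have "\<dots> < e" using elim by simp
      finally show ?case .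
    qed
  qed
qed

lemma bounded_domain_exp:
  assumes f: "f \<in> bounded_domain"
  shows "(\<lambda>x. exp (\<alpha> * f x)) \<in> bounded_domain"
proof -
  obtain M where M: "M > 0" "\<And>x. \<bar>f x\<bar> \<le> M" using f bounded_borelE by blast
  define K where "K = \<bar>\<alpha>\<bar> * M"
  show ?thesis
  proof (rule bounded_domain_lipschitz_comp[OF f _ M(2), where L = "exp K * \<bar>\<alpha>\<bar>" and \<psi> = "\<lambda>y. exp (\<alpha> * y)"])
    fix a b :: real assume ab: "\<bar>a\<bar> \<le> M" "\<bar>b\<bar> \<le> M"
    have K: "\<bar>\<alpha> * a\<bar> \<le> K" if "\<bar>a\<bar> \<le> M" for a
      unfolding K_def abs_mult using that by (intro mult_left_mono) auto
    \<comment> \<open>A one-sided Lipschitz estimate from \<open>1 + w \<le> e^w\<close> with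
      \<open>w = y - x\<close>; exchanging \<open>x\<close> and \<open>y\<close> gives the absolute
      value.\<close>
    have le: "exp x - exp y \<le> exp K * \<bar>x - y\<bar>" if "x \<le> K" for x y :: real
    proof -
      have "exp x * (1 - exp (y - x)) \<le> exp x * (x - y)"
        using exp_ge_add_one_self[of "y - x"] by (intro mult_left_mono) (linarith, simp)
      also have "\<dots> \<le> exp x * \<bar>x - y\<bar>" by (intro mult_left_mono) auto
      also have "\<dots> \<le> exp K * \<bar>x - y\<bar>" using that by (intro mult_right_mono) auto
      finally show ?thesis by (simp add: algebra_simps flip: exp_add)
    qed
    have "\<bar>exp (\<alpha> * a) - exp (\<alpha> * b)\<bar> \<le> exp K * \<bar>\<alpha> * a - \<alpha> * b\<bar>"
      using le[of "\<alpha> * a" "\<alpha> * b"] le[of "\<alpha> * b" "\<alpha> * a"] K[OF ab(1)] K[OF ab(2)]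
      by (auto simp: abs_le_iff abs_minus_commute)
    also have "\<dots> = exp K * \<bar>\<alpha>\<bar> * \<bar>a - b\<bar>" by (simp add: abs_mult flip: right_diff_distrib)
    finally show "\<bar>exp (\<alpha> * a) - exp (\<alpha> * b)\<bar> \<le> exp K * \<bar>\<alpha>\<bar> * \<bar>a - b\<bar>" .
  qed (auto intro!: continuous_intros)
qed

lemma bounded_domain_in_Db: "f \<in> bounded_domain \<Longrightarrow> f \<in> Db m D"
  unfolding Db_def Linf_def bounded_borel_def by (auto simp: measurable_m_iff)

text \<open>The pointwise estimate for twisted increments is integrated along the process, divided
  by \<open>t\<close>, and taken to the limit, where the quartic error disappears. The defining
  inequality of \<open>D0\<close> is then tested with \<open>h = e^(2\<alpha>f) u^2\<close>, which
  is in the bounded domain.\<close>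

lemma twisted_energy_le:
  assumes fd: "f \<in> bounded_domain"
    and f: "\<And>h. h \<in> bounded_domain \<Longrightarrow> Ienergy E f f h \<le> (\<integral>x. \<bar>h x\<bar> \<partial>m)"
    and u: "u \<in> bounded_domain"
  shows "- E (\<lambda>x. exp (\<alpha> * f x) * exp (\<alpha> * f x) * u x) u
     \<le> \<alpha>\<^sup>2 / 2 * (\<integral>x. exp (\<alpha> * f x) * exp (\<alpha> * f x) * (u x)\<^sup>2 \<partial>m)"
proof -
  define F where "F x = exp (\<alpha> * f x)" for x
  define h where "h x = (F x * u x)\<^sup>2" for x
  have Fd: "F \<in> bounded_domain" unfolding F_def by (rule bounded_domain_exp[OF fd])
  have FFu: "(\<lambda>x. F x * F x * u x) \<in> bounded_domain" by (intro bounded_domain_mult Fd u)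
  have hd: "h \<in> bounded_domain" unfolding h_def power2_eq_square by (intro bounded_domain_mult Fd u)
  have fhd: "(\<lambda>x. f x * h x) \<in> bounded_domain" by (intro bounded_domain_mult fd hd)
  have ffd: "(\<lambda>x. f x * f x) \<in> bounded_domain" by (intro bounded_domain_mult fd)
  obtain M where M: "M > 0" "\<And>x. \<bar>f x\<bar> \<le> M" using fd bounded_borelE by blast
  obtain W where W: "W > 0" "\<And>x. \<bar>h x\<bar> \<le> W" using hd bounded_borelE by blast
  define K where "K = W * exp (\<bar>\<alpha>\<bar> * (2 * M)) / 12 * \<alpha> ^ 4"
  have int4: "integrable P (\<lambda>\<omega>. (f (\<omega> 0) - f (\<omega> t)) ^ 4)" if "0 \<le> t" "t \<le> 1" for t
    using integrable_quartic_increment[of f] fd that by simp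
  have "- (2 * E (\<lambda>x. F x * F x * u x) u)
     \<le> \<alpha>\<^sup>2 / 2 * (2 * (2 * E (\<lambda>x. f x * h x) f) - 2 * E (\<lambda>x. f x * f x) h) + K * 0"
  proof (rule tendsto_le)
    show "((\<lambda>t. - (increment_form t (\<lambda>x. F x * F x * u x) u / t)) \<longlongrightarrow> - (2 * E (\<lambda>x. F x * F x * u x) u)) (at_right 0)"
      by (intro tendsto_intros increment_form_tendsto FFu u)
    show "((\<lambda>t. \<alpha>\<^sup>2 / 2 * (2 * (increment_form t (\<lambda>x. f x * h x) f / t) - increment_form t (\<lambda>x. f x * f x) h / t)
       + K * ((\<integral>\<omega>. (f (\<omega> 0) - f (\<omega> t)) ^ 4 \<partial>P) / t))
      \<longlongrightarrow> \<alpha>\<^sup>2 / 2 * (2 * (2 * E (\<lambda>x. f x * h x) f) - 2 * E (\<lambda>x. f x * f x) h) + K * 0) (at_right 0)"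
      by (intro tendsto_intros increment_form_tendsto quartic_increment_tendsto_0 fd hd fhd ffd)
    have "\<forall>\<^sub>F t::real in at_right 0. t \<in> {0<..<1}" by (intro eventually_at_right_real) auto
    then show "\<forall>\<^sub>F t in at_right 0. - (increment_form t (\<lambda>x. F x * F x * u x) u / t)
      \<le> \<alpha>\<^sup>2 / 2 * (2 * (increment_form t (\<lambda>x. f x * h x) f / t) - increment_form t (\<lambda>x. f x * f x) h / t)
       + K * ((\<integral>\<omega>. (f (\<omega> 0) - f (\<omega> t)) ^ 4 \<partial>P) / t)"
    proof eventually_elim
      case (elim t)
      then have t: "0 \<le> t" "t \<le> 1" "0 < t" by auto
      let ?I = "\<lambda>f g \<omega>. (f (\<omega> 0) - f (\<omega> t)) * (g (\<omega> 0) - g (\<omega> t)) :: real"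
      have i: "integrable P (?I (\<lambda>x. F x * F x * u x) u)" "integrable P (?I (\<lambda>x. f x * h x) f)"
        "integrable P (?I (\<lambda>x. f x * f x) h)"
        using FFu u fhd fd hd ffd by (auto intro!: integrable_increment t)
      have "- increment_form t (\<lambda>x. F x * F x * u x) u = (\<integral>\<omega>. - ?I (\<lambda>x. F x * F x * u x) u \<omega> \<partial>P)"
        by simp
      also have "\<dots> \<le> (\<integral>\<omega>. \<alpha>\<^sup>2 / 2 * (2 * ?I (\<lambda>x. f x * h x) f \<omega> - ?I (\<lambda>x. f x * f x) h \<omega>)
           + K * (f (\<omega> 0) - f (\<omega> t)) ^ 4 \<partial>P)"
      proof (rule integral_mono)
        show "integrable P (\<lambda>\<omega>. - ?I (\<lambda>x. F x * F x * u x) u \<omega>)" using i by simp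
        show "integrable P (\<lambda>\<omega>. \<alpha>\<^sup>2 / 2 * (2 * ?I (\<lambda>x. f x * h x) f \<omega> - ?I (\<lambda>x. f x * f x) h \<omega>)
           + K * (f (\<omega> 0) - f (\<omega> t)) ^ 4)"
          using i int4[OF t(1,2)] by (intro Bochner_Integration.integrable_add integrable_mult_right
              Bochner_Integration.integrable_diff) auto
        fix \<omega>
        show "- ?I (\<lambda>x. F x * F x * u x) u \<omega>
          \<le> \<alpha>\<^sup>2 / 2 * (2 * ?I (\<lambda>x. f x * h x) f \<omega> - ?I (\<lambda>x. f x * f x) h \<omega>)
           + K * (f (\<omega> 0) - f (\<omega> t)) ^ 4"
          unfolding K_def h_def F_def
          by (rule twisted_increment_le)
             (use M W(2)[of "\<omega> 0"] W(2)[of "\<omega> t"] in \<open>auto simp: h_def F_def\<close>)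
      qed
      also have "\<dots> = \<alpha>\<^sup>2 / 2 * (2 * increment_form t (\<lambda>x. f x * h x) f - increment_form t (\<lambda>x. f x * f x) h)
         + K * (\<integral>\<omega>. (f (\<omega> 0) - f (\<omega> t)) ^ 4 \<partial>P)"
        using i int4[OF t(1,2)] by simp
      finally have "- increment_form t (\<lambda>x. F x * F x * u x) u / t
        \<le> (\<alpha>\<^sup>2 / 2 * (2 * increment_form t (\<lambda>x. f x * h x) f - increment_form t (\<lambda>x. f x * f x) h)
         + K * (\<integral>\<omega>. (f (\<omega> 0) - f (\<omega> t)) ^ 4 \<partial>P)) / t"
        using t by (intro divide_right_mono) auto
      also have "\<dots> = \<alpha>\<^sup>2 / 2 * (2 * (increment_form t (\<lambda>x. f x * h x) f / t) - increment_form t (\<lambda>x. f x * f x) h / t)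
         + K * ((\<integral>\<omega>. (f (\<omega> 0) - f (\<omega> t)) ^ 4 \<partial>P) / t)"
        using t by (simp add: field_simps)
      finally show ?case by simp
    qed
  qed simp
  \<comment> \<open>Increment forms converge to twice the energy, which cancels the
    \<open>1/2\<close>. In the model case \<open>E f f = 1/2 \<integral> |grad f|^2\<close>, this
    \<open>I_f(h)\<close> is \<open>\<integral> h |grad f|^2\<close>.\<close>
  also have "\<dots> = \<alpha>\<^sup>2 * Ienergy E f f h" by (simp add: Ienergy_def algebra_simps)
  also have "\<dots> \<le> \<alpha>\<^sup>2 * (\<integral>x. \<bar>h x\<bar> \<partial>m)"
    by (intro mult_left_mono f hd) auto
  also have "(\<integral>x. \<bar>h x\<bar> \<partial>m) = (\<integral>x. F x * F x * (u x)\<^sup>2 \<partial>m)"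
    by (simp add: h_def power_mult_distrib power2_eq_square[of "F _"])
  finally show ?thesis by (simp add: F_def)
qed

end

section \<open>Gaussian bounds\<close>

text \<open>Nonnegativity rules out the value -\<infinity>, which \<open>real_of_ereal\<close> sends
  to 0.\<close>

lemma exp_neg_half_add:
  assumes "x \<ge> 0" "y \<ge> 0"
  shows "exp_neg_half (x + y) = exp_neg_half x * exp_neg_half y"
  using assms by (cases x; cases y) (auto simp: exp_neg_half_def algebra_simps simp flip: exp_add)

lemma exp_neg_half_nonneg: "exp_neg_half x \<ge> 0"
  by (simp add: exp_neg_half_def)

section \<open>Davies' weighted estimate\<close>

context dirichlet_process
begin

lemma weighted_contraction:
  assumes fd: "f \<in> bounded_domain"
    and f: "\<And>h. h \<in> bounded_domain \<Longrightarrow> Ienergy E f f h \<le> (\<integral>x. \<bar>h x\<bar> \<partial>m)"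
    and v: "v \<in> L2 m" "AE x in m. 0 \<le> v x \<and> v x \<le> 1" and s: "0 \<le> s"
  shows "(\<integral>x. exp (\<alpha> * f x) * exp (\<alpha> * f x) * (T s v x)\<^sup>2 \<partial>m)
    \<le> exp (\<alpha>\<^sup>2 * s) * (\<integral>x. exp (\<alpha> * f x) * exp (\<alpha> * f x) * (v x)\<^sup>2 \<partial>m)"
proof -
  define G where "G x = exp (\<alpha> * f x) * exp (\<alpha> * f x)" for x
  have Gd: "G \<in> bounded_domain" unfolding G_def by (intro bounded_domain_mult bounded_domain_exp fd)
  then obtain C where C: "C > 0" "\<And>x. \<bar>G x\<bar> \<le> C" using bounded_borelE by blast
  have Gm: "G \<in> borel_measurable m" using Gd bounded_borel_measurable measurable_m_iff by blast
  have G0: "G x \<ge> 0" for x by (simp add: G_def)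
  define \<phi> where "\<phi> \<sigma> = (\<integral>x. G x * (T \<sigma> v x)\<^sup>2 \<partial>m)" for \<sigma>
  have cont: "continuous_on {0..} \<phi>"
    using continuous_weighted_norm[OF v(1) Gm C(2)] by (simp add: \<phi>_def[abs_def])
  have der: "\<exists>d. d \<le> \<alpha>\<^sup>2 * \<phi> \<sigma> \<and> (\<phi> has_real_derivative d) (at_right \<sigma>)" if \<sigma>: "0 < \<sigma>" for \<sigma>
  proof -
    have Tm: "T \<sigma> v \<in> borel_measurable borel" using T_measurable \<sigma> v by auto
    \<comment> \<open>\<open>T \<sigma> v\<close> is between 0 and 1 only almost everywhere; the
      truncation is so everywhere and is a version of the same element of \<open>D\<close>.\<close>
    define u where "u x = max 0 (min 1 (T \<sigma> v x))" for x
    have ub: "u \<in> bounded_borel"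
      by (rule bounded_borelI[where C = 1]) (use Tm in \<open>auto simp: u_def[abs_def]\<close>)
    have uT: "AE x in m. T \<sigma> v x = u x"
      using T_unit[OF _ v, of \<sigma>] \<sigma> by (auto simp: u_def)
    have "u \<in> D"
      by (rule D_AE_cong(1)[OF T_in_D[OF v(1) \<sigma>] bounded_borel_L2[OF ub] uT])
    with ub have ud: "u \<in> bounded_domain" by simp
    have uL: "u \<in> L2 m" by (rule bounded_borel_L2[OF ub])
    have Gu: "(\<lambda>x. G x * u x) \<in> bounded_domain" by (intro bounded_domain_mult Gd ud)
    have GuL: "(\<lambda>x. G x * u x) \<in> L2 m" using Gu by (auto intro: bounded_borel_L2)
    have \<phi>\<sigma>: "\<phi> \<sigma> = (\<integral>x. G x * (u x)\<^sup>2 \<partial>m)"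
      unfolding \<phi>_def using uT Gm L2D(1)[OF T_L2[OF _ v(1)], of \<sigma>] L2D(1)[OF uL] \<sigma>
      by (intro integral_cong_AE) auto
    have \<phi>r: "\<phi> (r + \<sigma>) = (\<integral>x. G x * (T r u x)\<^sup>2 \<partial>m)" if r: "0 < r" for r
    proof -
      have "AE x in m. T (r + \<sigma>) v x = T r (T \<sigma> v) x" using T_add r \<sigma> v by auto
      moreover have "AE x in m. T r (T \<sigma> v) x = T r u x"
        using T_cong[OF _ T_L2[OF _ v(1)] uL uT] r \<sigma> by auto
      ultimately show ?thesis
        unfolding \<phi>_def using Gm L2D(1)[OF T_L2[OF _ v(1)], of "r + \<sigma>"] L2D(1)[OF T_L2[OF _ uL], of r] \<sigma> r
        by (intro integral_cong_AE) auto
    qed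
    define R where "R r = (\<integral>x. G x * (T r u x - u x)\<^sup>2 \<partial>m)" for r
    have R: "((\<lambda>r. (1 / r) * R r) \<longlongrightarrow> 0) (at_right 0)"
    proof (rule tendsto_sandwich[where f = "\<lambda>_. 0"
          and h = "\<lambda>r. C * ((1 / r) * (\<integral>x. (T r u x - u x)\<^sup>2 \<partial>m))"])
      show "((\<lambda>r. C * ((1 / r) * (\<integral>x. (T r u x - u x)\<^sup>2 \<partial>m))) \<longlongrightarrow> 0) (at_right 0)"
        using tendsto_mult_left[OF T_diff_square_over_t_tendsto_0, of u C] ud by simp
      have ev: "\<forall>\<^sub>F t::real in at_right 0. t \<in> {0<..<1}" by (intro eventually_at_right_real) auto
      then show "\<forall>\<^sub>F r in at_right 0. 0 \<le> (1 / r) * R r"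
        by eventually_elim (auto simp: R_def G0 intro!: divide_nonneg_pos)
      show "\<forall>\<^sub>F r in at_right 0. (1 / r) * R r \<le> C * ((1 / r) * (\<integral>x. (T r u x - u x)\<^sup>2 \<partial>m))"
        using ev
      proof eventually_elim
        case (elim r)
        then have L: "(\<lambda>x. T r u x - u x) \<in> L2 m" using uL by (auto intro!: L2_diff T_L2)
        have "R r \<le> (\<integral>x. C * (T r u x - u x)\<^sup>2 \<partial>m)"
          unfolding R_def using C(2)
          by (intro integral_mono integrable_bounded_mult[OF Gm C(2)] integrable_mult_right L2D(2)[OF L]
              mult_right_mono) (auto intro: order_trans[OF abs_ge_self])
        then show ?case using elim by (simp add: field_simps)
      qed
    qed simp
    have "((\<lambda>r. - 2 * approx_energy r u (\<lambda>x. G x * u x) + (1 / r) * R r)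
        \<longlongrightarrow> - 2 * E u (\<lambda>x. G x * u x) + 0) (at_right 0)"
      using ud Gu by (intro tendsto_intros approx_energy_tendsto R) auto
    moreover have "\<forall>\<^sub>F t::real in at_right 0. t \<in> {0<..<1}" by (intro eventually_at_right_real) auto
    then have "\<forall>\<^sub>F r in at_right 0. - 2 * approx_energy r u (\<lambda>x. G x * u x) + (1 / r) * R r
       = (\<phi> (r + \<sigma>) - \<phi> \<sigma>) / (r + \<sigma> - \<sigma>)"
    proof eventually_elim
      case (elim r)
      then have r: "r > 0" by simp
      have TL: "T r u \<in> L2 m" using uL r by (auto intro: T_L2)
      have dL: "(\<lambda>x. T r u x - u x) \<in> L2 m" by (rule L2_diff[OF TL uL])
      note i = integrable_bounded_mult[OF Gm C(2)]
      have "\<phi> (r + \<sigma>) - \<phi> \<sigma> = (\<integral>x. G x * (T r u x)\<^sup>2 - G x * (u x)\<^sup>2 \<partial>m)"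
        unfolding \<phi>r[OF r] \<phi>\<sigma> using i[OF L2D(2)[OF TL]] i[OF L2D(2)[OF uL]] by simp
      \<comment> \<open>The linear part is the energy quotient against \<open>G u\<close>; the
        square is the remainder \<open>R r\<close>, which is \<open>o(r)\<close>.\<close>
      also have "\<dots> = (\<integral>x. - 2 * ((u x - T r u x) * (G x * u x)) + G x * (T r u x - u x)\<^sup>2 \<partial>m)"
        by (intro Bochner_Integration.integral_cong) (auto simp: power2_eq_square algebra_simps)
      also have "\<dots> = - 2 * (\<integral>x. (u x - T r u x) * (G x * u x) \<partial>m) + R r"
        unfolding R_def using i[OF L2D(2)[OF dL]] L2_mult_integrable[OF L2_diff[OF uL TL] GuL] by simp
      finally show ?case using r by (simp add: field_simps)
    qed
    ultimately have "((\<lambda>r. (\<phi> (r + \<sigma>) - \<phi> \<sigma>) / (r + \<sigma> - \<sigma>)) \<longlongrightarrow> - 2 * E u (\<lambda>x. G x * u x) + 0) (at_right 0)"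
      by (rule Lim_transform_eventually)
    then have "(\<phi> has_real_derivative (- 2 * E u (\<lambda>x. G x * u x))) (at_right \<sigma>)"
      unfolding has_field_derivative_iff by (subst filterlim_at_right_to_0) simp
    moreover have "- 2 * E u (\<lambda>x. G x * u x) \<le> \<alpha>\<^sup>2 * \<phi> \<sigma>"
      using twisted_energy_le[OF fd f ud, of \<alpha>] E_sym[of u "\<lambda>x. G x * u x"] ud Gu
      by (simp add: \<phi>\<sigma> G_def)
    ultimately show ?thesis by blast
  qed
  \<comment> \<open>Gronwall by integrating factor, using right derivatives at positive times and
    continuity at 0.\<close>
  have "exp (- \<alpha>\<^sup>2 * s) * \<phi> s \<le> exp (- \<alpha>\<^sup>2 * 0) * \<phi> 0"
  proof (rule right_derivative_nonpos_imp_le[OF s])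
    show "continuous_on {0..s} (\<lambda>s. exp (- \<alpha>\<^sup>2 * s) * \<phi> s)"
      by (intro continuous_intros continuous_on_subset[OF cont]) auto
    fix \<sigma> assume "0 < \<sigma>" "\<sigma> < s"
    then obtain d where d: "d \<le> \<alpha>\<^sup>2 * \<phi> \<sigma>" "(\<phi> has_real_derivative d) (at_right \<sigma>)" using der by blast
    have "((\<lambda>s. exp (- \<alpha>\<^sup>2 * s) * \<phi> s) has_real_derivative
        (exp (- \<alpha>\<^sup>2 * \<sigma>) * (- \<alpha>\<^sup>2)) * \<phi> \<sigma> + d * exp (- \<alpha>\<^sup>2 * \<sigma>)) (at_right \<sigma>)"
      by (rule DERIV_mult[OF _ d(2)]) (auto intro!: derivative_eq_intros)
    moreover have "(exp (- \<alpha>\<^sup>2 * \<sigma>) * (- \<alpha>\<^sup>2)) * \<phi> \<sigma> + d * exp (- \<alpha>\<^sup>2 * \<sigma>)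
        = exp (- \<alpha>\<^sup>2 * \<sigma>) * (d - \<alpha>\<^sup>2 * \<phi> \<sigma>)" by (simp add: algebra_simps)
    moreover have "\<dots> \<le> 0" using d(1) by (simp add: mult_le_0_iff)
    ultimately show "\<exists>d\<le>0. ((\<lambda>s. exp (- \<alpha>\<^sup>2 * s) * \<phi> s) has_real_derivative d) (at_right \<sigma>)" by metis
  qed
  also have "\<phi> 0 = (\<integral>x. G x * (v x)\<^sup>2 \<partial>m)"
    unfolding \<phi>_def using T_0[OF v(1)] Gm L2D(1)[OF v(1)] L2D(1)[OF T_L2[OF order_refl v(1)]]
    by (intro integral_cong_AE) auto
  finally show ?thesis
    by (simp add: \<phi>_def G_def exp_minus field_simps)
qed

section \<open>From test functions to the intrinsic distance\<close>

lemma Db_bounded_version: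
  assumes f: "f \<in> Db m D"
  obtains f' where "f' \<in> bounded_domain" "AE x in m. f x = f' x"
proof -
  obtain C where C: "AE x in m. \<bar>f x\<bar> \<le> C" and fm: "f \<in> borel_measurable m" and fD: "f \<in> D"
    using f by (auto simp: Db_def Linf_def)
  define f' where "f' x = max (- \<bar>C\<bar>) (min \<bar>C\<bar> (f x))" for x
  have b: "f' \<in> bounded_borel"
    by (rule bounded_borelI[where C = "\<bar>C\<bar>"]) (use fm in \<open>auto simp: f'_def[abs_def] measurable_m_iff\<close>)
  have ae: "AE x in m. f x = f' x" using C by eventually_elim (auto simp: f'_def)
  have "f' \<in> D" by (rule D_AE_cong(1)[OF fD bounded_borel_L2[OF b] ae])
  with b ae that show ?thesis by blast
qed

lemma Ienergy_bounded_version: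
  assumes f: "f \<in> Db m D" and f': "f' \<in> bounded_domain" "AE x in m. f x = f' x"
    and h: "h \<in> bounded_domain"
  shows "Ienergy E f' f' h = Ienergy E f f h"
proof -
  have fD: "f \<in> D" and fm: "f \<in> borel_measurable m" using f by (auto simp: Db_def Linf_def)
  have f'm: "f' \<in> borel_measurable m" and hm: "h \<in> borel_measurable m"
    using f' h by (auto simp: measurable_m_iff bounded_borel_measurable)
  have mult: "(\<lambda>x. f' x * h x) \<in> bounded_domain" "(\<lambda>x. f' x * f' x) \<in> bounded_domain"
    by (intro bounded_domain_mult f' h)+
  \<comment> \<open>The form respects almost everywhere equality only for a new function already
    known to be square integrable. The products with the original \<open>f\<close> inherit this from
    those with \<open>f'\<close>.\<close>
  have L2_cong: "g \<in> L2 m" if "g' \<in> bounded_domain" "AE x in m. g' x = g x" "g \<in> borel_measurable m" for g g'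
  proof -
    have "g' \<in> L2 m" using that by (auto intro: D_L2)
    moreover have "integrable m (\<lambda>x. (g' x)\<^sup>2) \<longleftrightarrow> integrable m (\<lambda>x. (g x)\<^sup>2)"
      using that \<open>g' \<in> L2 m\<close> by (intro integrable_cong_AE) (auto simp: L2_def)
    ultimately show ?thesis using that by (auto simp: L2_def)
  qed
  have a1: "AE x in m. f' x * h x = f x * h x" and a2: "AE x in m. f' x * f' x = f x * f x"
    using f'(2) by auto
  have l1: "(\<lambda>x. f x * h x) \<in> L2 m" by (rule L2_cong[OF mult(1) a1]) (use fm hm in auto)
  have l2: "(\<lambda>x. f x * f x) \<in> L2 m" by (rule L2_cong[OF mult(2) a2]) (use fm in auto)
  have "E (\<lambda>x. f x * h x) f = E (\<lambda>x. f' x * h x) f"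
    using D_AE_cong(2)[OF _ l1 a1 fD] mult by simp
  also have "\<dots> = E (\<lambda>x. f' x * h x) f'"
    using D_AE_cong(3)[OF fD D_L2 f'(2), of "\<lambda>x. f' x * h x"] f'(1) mult by simp
  finally have "E (\<lambda>x. f x * h x) f = E (\<lambda>x. f' x * h x) f'" .
  moreover have "E (\<lambda>x. f x * f x) h = E (\<lambda>x. f' x * f' x) h"
    using D_AE_cong(2)[OF _ l2 a2, of h] mult h by simp
  ultimately show ?thesis by (simp add: Ienergy_def)
qed

text \<open>The weight \<open>e^(-2lf)\<close> is at least \<open>e^(-2la)\<close> on
  \<open>A\<close> and at most \<open>e^(-2lb)\<close> on \<open>B\<close>, where \<open>v\<close>
  lives. The weighted contraction with \<open>\<alpha> = -l\<close> compares the two.\<close>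

lemma gaussian_bound_of_test_function:
  assumes f: "f \<in> D0 m E D" and A: "A \<in> sets m"
    and fA: "AE x in m. x \<in> A \<longrightarrow> f x \<le> a" and fB: "AE x in m. x \<in> B \<longrightarrow> b \<le> f x"
    and r: "0 \<le> r" "r \<le> b - a" and s: "0 < s"
    and v: "v \<in> L2 m" "AE x in m. 0 \<le> v x \<and> v x \<le> 1" "\<And>x. x \<notin> B \<Longrightarrow> v x = 0"
  shows "(\<integral>x. (indicator A x * T s v x)\<^sup>2 \<partial>m) \<le> exp (- (r\<^sup>2 / s)) * (\<integral>x. (v x)\<^sup>2 \<partial>m)"
proof -
  have fDb: "f \<in> Db m D" using f by (simp add: D0_def)
  obtain g where g: "g \<in> bounded_domain" "AE x in m. f x = g x" using Db_bounded_version[OF fDb] .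
  have gI: "Ienergy E g g h \<le> (\<integral>x. \<bar>h x\<bar> \<partial>m)" if "h \<in> bounded_domain" for h
    using Ienergy_bounded_version[OF fDb g that] f bounded_domain_in_Db[OF that] by (simp add: D0_def)
  \<comment> \<open>The minimiser of the final exponent \<open>2la + l^2 s - 2lb\<close>, with
    minimum \<open>-(b - a)^2 / s\<close>. This is twice the Gaussian exponent since squared norms
    are compared.\<close>
  define l where "l = (b - a) / s"
  define G where "G x = exp (- l * g x) * exp (- l * g x)" for x
  have l0: "l \<ge> 0" using r s by (simp add: l_def)
  have Gd: "G \<in> bounded_domain" unfolding G_def by (intro bounded_domain_mult bounded_domain_exp g)
  then obtain C where C: "C > 0" "\<And>x. \<bar>G x\<bar> \<le> C" using bounded_borelE by blast
  have Gm: "G \<in> borel_measurable m" using Gd bounded_borel_measurable measurable_m_iff by blast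
  have G: "G x = exp (- 2 * l * g x)" for x by (simp add: G_def flip: exp_add)
  have TL: "T s v \<in> L2 m" using s v by (auto intro: T_L2)
  have indL: "integrable m (\<lambda>x. (indicator A x * T s v x)\<^sup>2)"
  proof -
    have "integrable m (\<lambda>x. indicator A x * (T s v x)\<^sup>2)"
      by (rule integrable_bounded_mult[where C = 1]) (use A L2D(2)[OF TL] in \<open>auto simp: indicator_def\<close>)
    moreover have "(\<lambda>x. (indicator A x * T s v x)\<^sup>2) = (\<lambda>x. indicator A x * (T s v x)\<^sup>2)"
      by (auto simp: indicator_def)
    ultimately show ?thesis by simp
  qed
  have "exp (- 2 * l * a) * (\<integral>x. (indicator A x * T s v x)\<^sup>2 \<partial>m)
     = (\<integral>x. exp (- 2 * l * a) * (indicator A x * T s v x)\<^sup>2 \<partial>m)" by simp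
  also have "\<dots> \<le> (\<integral>x. G x * (T s v x)\<^sup>2 \<partial>m)"
  proof (rule integral_mono_AE)
    show "integrable m (\<lambda>x. G x * (T s v x)\<^sup>2)" by (rule integrable_bounded_mult[OF Gm C(2) L2D(2)[OF TL]])
    show "AE x in m. exp (- 2 * l * a) * (indicator A x * T s v x)\<^sup>2 \<le> G x * (T s v x)\<^sup>2"
      using fA g(2)
    proof eventually_elim
      case (elim x)
      show ?case
      proof (cases "x \<in> A")
        case True
        then have "2 * l * g x \<le> 2 * l * a" using elim l0 by (intro mult_left_mono) auto
        then show ?thesis using True by (auto simp: G intro!: mult_right_mono)
      qed (auto simp: G)
    qed
  qed (use indL in auto)
  also have "\<dots> \<le> exp ((- l)\<^sup>2 * s) * (\<integral>x. G x * (v x)\<^sup>2 \<partial>m)"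
    unfolding G_def by (rule weighted_contraction[OF g(1) gI v(1,2)]) (use s in auto)
  also have "\<dots> \<le> exp ((- l)\<^sup>2 * s) * (\<integral>x. exp (- 2 * l * b) * (v x)\<^sup>2 \<partial>m)"
  proof (intro mult_left_mono integral_mono_AE)
    show "integrable m (\<lambda>x. G x * (v x)\<^sup>2)" by (rule integrable_bounded_mult[OF Gm C(2) L2D(2)[OF v(1)]])
    show "AE x in m. G x * (v x)\<^sup>2 \<le> exp (- 2 * l * b) * (v x)\<^sup>2"
      using fB g(2)
    proof eventually_elim
      case (elim x)
      show ?case
      proof (cases "x \<in> B")
        case True
        then have "2 * l * b \<le> 2 * l * g x" using elim l0 by (intro mult_left_mono) auto
        then show ?thesis by (auto simp: G intro!: mult_right_mono)
      qed (use v(3) in auto)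
    qed
  qed (use L2D(2)[OF v(1)] in auto)
  finally have "exp (- 2 * l * a) * (\<integral>x. (indicator A x * T s v x)\<^sup>2 \<partial>m)
      \<le> exp (l\<^sup>2 * s) * exp (- 2 * l * b) * (\<integral>x. (v x)\<^sup>2 \<partial>m)" by simp
  then have le: "exp (2 * l * a) * (exp (- 2 * l * a) * (\<integral>x. (indicator A x * T s v x)\<^sup>2 \<partial>m))
      \<le> exp (2 * l * a) * (exp (l\<^sup>2 * s) * exp (- 2 * l * b) * (\<integral>x. (v x)\<^sup>2 \<partial>m))"
    by (rule mult_left_mono) simp
  have "(\<integral>x. (indicator A x * T s v x)\<^sup>2 \<partial>m)
      \<le> exp (2 * l * a + (l\<^sup>2 * s + - 2 * l * b)) * (\<integral>x. (v x)\<^sup>2 \<partial>m)"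
  proof -
    have "exp (2 * l * a) * exp (- 2 * l * a) = 1" by (simp flip: exp_add)
    then have "exp (2 * l * a) * (exp (- 2 * l * a) * z) = z" for z
      by (simp only: mult.assoc[symmetric] mult_1)
    moreover have "exp (2 * l * a + (l\<^sup>2 * s + - 2 * l * b)) = exp (2 * l * a) * (exp (l\<^sup>2 * s) * exp (- 2 * l * b))"
      by (simp only: exp_add)
    ultimately show ?thesis using le by (simp only: mult.assoc)
  qed
  also have "2 * l * a + (l\<^sup>2 * s + - 2 * l * b) = - ((b - a)\<^sup>2 / s)"
    using s by (simp add: l_def power2_eq_square field_simps)
  also have "exp (- ((b - a)\<^sup>2 / s)) * (\<integral>x. (v x)\<^sup>2 \<partial>m) \<le> exp (- (r\<^sup>2 / s)) * (\<integral>x. (v x)\<^sup>2 \<partial>m)"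
    using r s by (intro mult_right_mono) (auto intro!: divide_right_mono power_mono)
  finally show ?thesis .
qed

lemma zero_in_D0: "(\<lambda>_. 0) \<in> D0 m E D"
proof -
  have "(\<lambda>_. 0) \<in> bounded_domain" using zero_in_D by (auto intro: bounded_borelI[where C = 0])
  then show ?thesis
    using bounded_domain_in_Db[of "\<lambda>_. 0"] unfolding D0_def
    by (auto simp: Ienergy_def E_zero_left zero_in_D Db_def)
qed

text \<open>The zero function competes in the supremum. This excludes the value -\<infinity>, whose
  square would be \<infinity>.\<close>

lemma intrinsic_dist_nonneg: "0 \<le> intrinsic_dist m E D A B"
proof -
  have "0 \<le> ess_inf_on m B (\<lambda>_. 0)"
    unfolding ess_inf_on_def by (rule Sup_upper) simp
  moreover have "ess_sup_on m A (\<lambda>_. 0) \<le> 0"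
    unfolding ess_sup_on_def by (rule Inf_lower) simp
  ultimately have "0 - 0 \<le> ess_inf_on m B (\<lambda>_. 0) - ess_sup_on m A (\<lambda>_. 0)"
    by (rule ereal_minus_mono)
  also have "\<dots> \<le> intrinsic_dist m E D A B"
    unfolding intrinsic_dist_def by (rule SUP_upper[OF zero_in_D0])
  finally show ?thesis by simp
qed

text \<open>Turns a strict bound in the extended reals into real levels \<open>a\<close> and
  \<open>b\<close> for a single test function.\<close>

lemma intrinsic_dist_witness:
  assumes r: "ereal r < intrinsic_dist m E D A B"
  obtains f a b where "f \<in> D0 m E D" "AE x in m. x \<in> A \<longrightarrow> f x \<le> a"
    "AE x in m. x \<in> B \<longrightarrow> b \<le> f x" "r \<le> b - a"
proof -
  obtain f where f: "f \<in> D0 m E D" and less: "ereal r < ess_inf_on m B f - ess_sup_on m A f"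
    using r unfolding intrinsic_dist_def less_SUP_iff by blast
  obtain C where C: "AE x in m. \<bar>f x\<bar> \<le> C" using f by (auto simp: D0_def Db_def Linf_def)
  \<comment> \<open>Essential boundedness of \<open>f\<close> keeps the difference away from
    \<infinity> - \<infinity>. The infinities that remain are an essential infimum \<infinity> and
    an essential supremum -\<infinity>, as on null sets; there the missing level can be chosen
    freely.\<close>
  have lo: "ereal (- C) \<le> ess_inf_on m B f"
    unfolding ess_inf_on_def by (rule Sup_upper) (use C in \<open>auto elim!: eventually_mono\<close>)
  have hi: "ess_sup_on m A f \<le> ereal C"
    unfolding ess_sup_on_def by (rule Inf_lower) (use C in \<open>auto elim!: eventually_mono\<close>)
  have "\<exists>a b. ess_sup_on m A f < ereal a \<and> ereal b < ess_inf_on m B f \<and> r \<le> b - a"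
  proof (cases "ess_inf_on m B f"; cases "ess_sup_on m A f")
    fix \<beta> \<alpha> assume eq: "ess_inf_on m B f = ereal \<beta>" "ess_sup_on m A f = ereal \<alpha>"
    define e where "e = (\<beta> - \<alpha> - r) / 2"
    have "e > 0" using less eq by (simp add: e_def)
    then show ?thesis using eq by (intro exI[of _ "\<alpha> + e"] exI[of _ "\<beta> - e"]) (auto simp: e_def field_simps)
  next
    fix \<beta> assume eq: "ess_inf_on m B f = ereal \<beta>" "ess_sup_on m A f = -\<infinity>"
    then show ?thesis by (intro exI[of _ "\<beta> - 1 - r"] exI[of _ "\<beta> - 1"]) auto
  next
    fix \<alpha> assume eq: "ess_inf_on m B f = \<infinity>" "ess_sup_on m A f = ereal \<alpha>"
    then show ?thesis by (intro exI[of _ "\<alpha> + 1"] exI[of _ "\<alpha> + 1 + r"]) auto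
  next
    assume eq: "ess_inf_on m B f = \<infinity>" "ess_sup_on m A f = -\<infinity>"
    then show ?thesis by (intro exI[of _ 0] exI[of _ r]) auto
  qed (use lo hi in auto)
  then obtain a b where ab: "ess_sup_on m A f < ereal a" "ereal b < ess_inf_on m B f" "r \<le> b - a" by blast
  have "AE x in m. x \<in> A \<longrightarrow> f x \<le> a"
  proof -
    obtain z where "AE x in m. x \<in> A \<longrightarrow> ereal (f x) \<le> z" "z < ereal a"
      using ab(1) unfolding ess_sup_on_def Inf_less_iff by blast
    then show ?thesis by (auto elim!: eventually_mono) (metis ereal_less_eq(3) less_imp_le order_trans)
  qed
  moreover have "AE x in m. x \<in> B \<longrightarrow> b \<le> f x"
  proof -
    obtain z where "AE x in m. x \<in> B \<longrightarrow> z \<le> ereal (f x)" "ereal b < z"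
      using ab(2) unfolding ess_inf_on_def less_Sup_iff by blast
    then show ?thesis by (auto elim!: eventually_mono) (metis ereal_less_eq(3) less_imp_le order_trans)
  qed
  ultimately show ?thesis using that f ab(3) by blast
qed

text \<open>The supremum defining the distance need not be attained, so the bound is shown for every
  \<open>r\<close> below it and \<open>r\<close> tends to the distance, or to \<infinity> if it is
  infinite.\<close>

lemma gaussian_bound:
  assumes A: "A \<in> sets m" and s: "0 < s"
    and v: "v \<in> L2 m" "AE x in m. 0 \<le> v x \<and> v x \<le> 1" "\<And>x. x \<notin> B \<Longrightarrow> v x = 0"
  shows "(\<integral>x. (indicator A x * T s v x)\<^sup>2 \<partial>m)
    \<le> (exp_neg_half ((intrinsic_dist m E D A B)\<^sup>2 / ereal s))\<^sup>2 * (\<integral>x. (v x)\<^sup>2 \<partial>m)" (is "?I \<le> _ * ?V")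
proof -
  have lt: "?I \<le> exp (- (r\<^sup>2 / s)) * ?V" if r: "0 \<le> r" "ereal r < intrinsic_dist m E D A B" for r
  proof -
    obtain f a b where "f \<in> D0 m E D" "AE x in m. x \<in> A \<longrightarrow> f x \<le> a"
      "AE x in m. x \<in> B \<longrightarrow> b \<le> f x" "r \<le> b - a"
      using intrinsic_dist_witness[OF r(2)] .
    then show ?thesis using A r(1) s v by (intro gaussian_bound_of_test_function)
  qed
  show ?thesis
  proof (cases "intrinsic_dist m E D A B")
    case (real d)
    have d: "0 \<le> d" using intrinsic_dist_nonneg[of A B] real by simp
    have "?I \<le> exp (- (d\<^sup>2 / s)) * ?V"
    proof (cases "d = 0")
      case True
      \<comment> \<open>For \<open>d = 0\<close> there is no \<open>r\<close> with
        \<open>0 \<le> r < d\<close>; contractivity of \<open>T s\<close> is the whole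
        claim.\<close>
      have TL: "T s v \<in> L2 m" using s v by (auto intro: T_L2)
      have "?I \<le> (\<integral>x. (T s v x)\<^sup>2 \<partial>m)"
      proof (rule integral_mono')
        show "integrable m (\<lambda>x. (T s v x)\<^sup>2)" by (rule L2D(2)[OF TL])
      qed (auto simp: indicator_def)
      also have "\<dots> \<le> ?V" using s v by (intro T_contract) auto
      finally show ?thesis using True by simp
    next
      case False
      show ?thesis
      proof (rule tendsto_lowerbound)
        show "((\<lambda>r. exp (- (r\<^sup>2 / s)) * ?V) \<longlongrightarrow> exp (- (d\<^sup>2 / s)) * ?V) (at_left d)"
          using s by (intro tendsto_intros) auto
        have "\<forall>\<^sub>F r in at_left d. r \<in> {0<..<d}"
          using False d by (intro eventually_at_left_real) auto
        then show "\<forall>\<^sub>F r in at_left d. ?I \<le> exp (- (r\<^sup>2 / s)) * ?V"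
          by eventually_elim (auto intro!: lt simp: real)
      qed simp
    qed
    moreover have "(exp_neg_half ((ereal d)\<^sup>2 / ereal s))\<^sup>2 = exp (- (d\<^sup>2 / s))"
      using s by (simp add: exp_neg_half_def power2_eq_square flip: exp_add)
    ultimately show ?thesis using real by simp
  next
    case PInf
    have "?I \<le> 0"
    proof (rule tendsto_lowerbound)
      have "filterlim (\<lambda>r::real. (1 / s) * r\<^sup>2) at_top at_top"
        using s by (intro filterlim_tendsto_pos_mult_at_top[OF tendsto_const] filterlim_pow_at_top
            filterlim_ident) auto
      then have "((\<lambda>r. exp (- (r\<^sup>2 / s))) \<longlongrightarrow> 0) at_top"
        by (intro filterlim_compose[OF exp_at_bot]) (simp add: filterlim_uminus_at_bot)
      then show "((\<lambda>r. exp (- (r\<^sup>2 / s)) * ?V) \<longlongrightarrow> 0) at_top"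
        using tendsto_mult_right[of "\<lambda>r. exp (- (r\<^sup>2 / s))" 0 at_top ?V] by simp
      show "\<forall>\<^sub>F r in at_top. ?I \<le> exp (- (r\<^sup>2 / s)) * ?V"
        using eventually_ge_at_top[of 0] by eventually_elim (auto intro!: lt simp: PInf)
    qed simp
    moreover have "exp_neg_half (\<infinity>\<^sup>2 / ereal s) = 0"
      using s by (simp add: exp_neg_half_def power2_eq_square)
    ultimately show ?thesis using PInf by simp
  next
    case MInf
    then show ?thesis using intrinsic_dist_nonneg[of A B] by simp
  qed
qed

section \<open>Composition along the partition\<close>

context
  fixes n :: nat and t :: "nat \<Rightarrow> real" and A :: "nat \<Rightarrow> 'a set"
  assumes t0: "t 0 = 0" and tn: "t n = 1" and t_less: "\<And>i. i < n \<Longrightarrow> t i < t (Suc i)"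
    and A: "\<And>i. i \<le> n \<Longrightarrow> A i \<in> sets m"
begin

lemma t_mono: "i \<le> j \<Longrightarrow> j \<le> n \<Longrightarrow> t i \<le> t j"
proof (induction j rule: dec_induct)
  case (step k)
  then show ?case using t_less[of k] by simp
qed simp

lemma t_bounds: "i \<le> n \<Longrightarrow> 0 \<le> t i" "i \<le> n \<Longrightarrow> t i \<le> 1"
  using t_mono[of 0 i] t_mono[of i n] t0 tn by auto

lemma nested_properties:
  assumes "j \<le> n"
  shows "nested T t A n j \<in> L2 m" "AE x in m. 0 \<le> nested T t A n j x \<and> nested T t A n j x \<le> 1"
    "\<And>x. x \<notin> A (n - j) \<Longrightarrow> nested T t A n j x = 0"
proof -
  have "nested T t A n j \<in> L2 m \<and> (AE x in m. 0 \<le> nested T t A n j x \<and> nested T t A n j x \<le> 1)"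
    using assms
  proof (induction j)
    case 0
    have "(indicator (A n) :: 'a \<Rightarrow> real) \<in> L2 m"
      using A[of n] sets_m by (intro bounded_borel_L2 indicator_bounded_borel) auto
    then show ?case by simp
  next
    case (Suc j)
    define k where "k = n - Suc j"
    have k: "n - j = Suc k" "k < n" using Suc.prems by (auto simp: k_def)
    have s: "0 \<le> t (Suc k) - t k" using t_less[OF k(2)] by simp
    have IH: "nested T t A n j \<in> L2 m" "AE x in m. 0 \<le> nested T t A n j x \<and> nested T t A n j x \<le> 1"
      using Suc by auto
    have TL: "T (t (Suc k) - t k) (nested T t A n j) \<in> L2 m" by (rule T_L2[OF s IH(1)])
    have unit: "AE x in m. 0 \<le> T (t (Suc k) - t k) (nested T t A n j) x \<and> T (t (Suc k) - t k) (nested T t A n j) x \<le> 1"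
      by (rule T_unit[OF s IH])
    have eq: "nested T t A n (Suc j) = (\<lambda>x. indicator (A k) x * T (t (Suc k) - t k) (nested T t A n j) x)"
      using k(1) by (simp add: k_def)
    have "AE x in m. 0 \<le> nested T t A n (Suc j) x \<and> nested T t A n (Suc j) x \<le> 1"
      using unit unfolding eq by eventually_elim (auto simp: indicator_def)
    moreover have "nested T t A n (Suc j) \<in> borel_measurable m"
      unfolding eq using A[of k] k L2D(1)[OF TL] by (intro borel_measurable_times borel_measurable_indicator) auto
    moreover from calculation(1) have "AE x in m. \<bar>nested T t A n (Suc j) x\<bar> \<le> 1"
      by (rule eventually_mono) (simp del: nested.simps)
    ultimately show ?case by (blast intro: bounded_in_L2)
  qed
  then show "nested T t A n j \<in> L2 m" "AE x in m. 0 \<le> nested T t A n j x \<and> nested T t A n j x \<le> 1" by auto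
  show "nested T t A n j x = 0" if "x \<notin> A (n - j)" for x using that by (cases j) auto
qed

text \<open>\<open>nested T t A n j\<close> vanishes off \<open>A (n - j)\<close>, so each further
  layer fits the Gaussian bound between two consecutive sets and contributes one factor. The
  innermost indicator contributes \<open>m(A_n)\<close>.\<close>

lemma nested_norm_le:
  assumes "j \<le> n"
  shows "(\<integral>x. (nested T t A n j x)\<^sup>2 \<partial>m) \<le> measure m (A n) *
    (exp_neg_half (\<Sum>i\<in>{n - j..<n}. (intrinsic_dist m E D (A i) (A (Suc i)))\<^sup>2 / ereal (t (Suc i) - t i)))\<^sup>2"
  using assms
proof (induction j)
  case 0
  have "(\<integral>x. (nested T t A n 0 x)\<^sup>2 \<partial>m) = (\<integral>x. indicator (A n) x \<partial>m)"
    by (intro Bochner_Integration.integral_cong) (auto simp: indicator_def)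
  then show ?case using A[of n] by (simp add: exp_neg_half_def space_m)
next
  case (Suc j)
  define k where "k = n - Suc j"
  have k: "n - j = Suc k" "k < n" using Suc.prems by (auto simp: k_def)
  define Q where "Q i = (intrinsic_dist m E D (A i) (A (Suc i)))\<^sup>2 / ereal (t (Suc i) - t i)" for i
  have Q0: "Q i \<ge> 0" if "i < n" for i
    unfolding Q_def using t_less[OF that] by (intro zero_le_divide_ereal) (auto simp: power2_eq_square intrinsic_dist_nonneg)
  have s: "0 < t (Suc k) - t k" using t_less[OF k(2)] by simp
  note np = nested_properties[of j]
  have eq: "nested T t A n (Suc j) = (\<lambda>x. indicator (A k) x * T (t (Suc k) - t k) (nested T t A n j) x)"
    using k(1) by (simp add: k_def)
  have "(\<integral>x. (nested T t A n (Suc j) x)\<^sup>2 \<partial>m) \<le> (exp_neg_half (Q k))\<^sup>2 * (\<integral>x. (nested T t A n j x)\<^sup>2 \<partial>m)"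
    unfolding eq Q_def
    by (rule gaussian_bound[OF A s]) (use k np Suc.prems in auto)
  also have "\<dots> \<le> (exp_neg_half (Q k))\<^sup>2 * (measure m (A n) * (exp_neg_half (\<Sum>i\<in>{Suc k..<n}. Q i))\<^sup>2)"
    using Suc k by (intro mult_left_mono) (auto simp: Q_def)
  also have "\<dots> = measure m (A n) * (exp_neg_half (Q k) * exp_neg_half (\<Sum>i\<in>{Suc k..<n}. Q i))\<^sup>2"
    by (simp add: power_mult_distrib)
  also have "exp_neg_half (Q k) * exp_neg_half (\<Sum>i\<in>{Suc k..<n}. Q i) = exp_neg_half (Q k + (\<Sum>i\<in>{Suc k..<n}. Q i))"
    using Q0 k by (intro exp_neg_half_add[symmetric] sum_nonneg) auto
  also have "Q k + (\<Sum>i\<in>{Suc k..<n}. Q i) = (\<Sum>i\<in>{k..<n}. Q i)"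
    using k by (simp add: sum.atLeast_Suc_lessThan)
  finally show ?case by (simp add: Q_def k_def)
qed

text \<open>The induction peels off the last time first. The event \<open>B\<close> of the past is
  arbitrary, so that the condition at time \<open>t k\<close> can be absorbed into it before the
  hypothesis is applied.\<close>

lemma prob_cylinder:
  assumes "j \<le> n" "B \<in> sets (path_filtration (t (n - j)))"
  shows "measure P (B \<inter> {\<omega>\<in>paths. \<forall>i\<in>{n - j..n}. \<omega> (t i) \<in> A i})
    = (LINT \<omega>:B|P. nested T t A n j (\<omega> (t (n - j))))"
  using assms
proof (induction j arbitrary: B)
  case 0
  have B: "B \<in> sets P" using 0 t_bounds[of n] by (intro path_filtration_sets_P[of "t n"]) auto
  then have Bp: "B \<subseteq> paths" using sets.sets_into_space space_P by blast
  have "{\<omega>\<in>paths. \<omega> (t n) \<in> A n} = (\<lambda>\<omega>. \<omega> (t n)) -` A n \<inter> space P" by (auto simp: space_P)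
  also have "\<dots> \<in> sets P"
    using measurable_coordinate_P[of "t n"] t_bounds[of n] A[of n] sets_m by (intro measurable_sets) auto
  finally have meas: "B \<inter> {\<omega>\<in>paths. \<omega> (t n) \<in> A n} \<in> sets P" using B by blast
  have "(LINT \<omega>:B|P. nested T t A n 0 (\<omega> (t n))) = (\<integral>\<omega>. indicator (B \<inter> {\<omega>\<in>paths. \<omega> (t n) \<in> A n}) \<omega> \<partial>P)"
    unfolding set_lebesgue_integral_def using Bp
    by (intro Bochner_Integration.integral_cong) (auto simp: indicator_def)
  also have "\<dots> = measure P (B \<inter> {\<omega>\<in>paths. \<omega> (t n) \<in> A n})" using meas by simp
  finally show ?case by simp
next
  case (Suc j)
  define k where "k = n - Suc j"
  have k: "n - j = Suc k" "k < n" using Suc.prems by (auto simp: k_def)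
  have j: "j \<le> n" using Suc.prems by simp
  define s where "s = t (Suc k) - t k"
  have s: "0 \<le> s" using t_less[OF k(2)] by (simp add: s_def)
  have tk: "0 \<le> t k" "t k \<le> 1" "0 \<le> t (Suc k)" "t (Suc k) \<le> 1" using t_bounds k by auto
  define g where "g = nested T t A n j"
  note np = nested_properties[OF j, folded g_def]
  have gm: "g \<in> borel_measurable borel" using L2D(1)[OF np(1)] measurable_m_iff by blast
  \<comment> \<open>The Markov property asks for a bound at every point, and \<open>g\<close> is
    between 0 and 1 only almost everywhere. By stationarity the exchange of \<open>g\<close> and
    \<open>g'\<close> is harmless at time \<open>t (Suc k)\<close>, and that of their images under
    \<open>T s\<close> at time \<open>t k\<close>.\<close>
  define g' where "g' x = max 0 (min 1 (g x))" for x
  have g': "g' \<in> bounded_borel" by (rule bounded_borelI[where C = 1]) (use gm in \<open>auto simp: g'_def[abs_def]\<close>)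
  have gg': "AE x in m. g x = g' x" using np(2) by eventually_elim (auto simp: g'_def)
  have Tgm: "T s g \<in> borel_measurable borel" "T s g' \<in> borel_measurable borel"
    using T_measurable[OF s] np(1) bounded_borel_L2[OF g'] by auto
  have TT: "AE x in m. T s g x = T s g' x"
    by (rule T_cong[OF s np(1) bounded_borel_L2[OF g'] gg'])
  have eq: "nested T t A n (Suc j) = (\<lambda>x. indicator (A k) x * T s g x)"
    using k(1) by (simp add: k_def s_def g_def)
  define B' where "B' = B \<inter> {\<omega>\<in>paths. \<omega> (t k) \<in> A k}"
  have B: "B \<in> sets (path_filtration (t k))" using Suc.prems by (simp add: k_def)
  have "{\<omega>\<in>paths. \<omega> (t k) \<in> A k} = (\<lambda>\<omega>. \<omega> (t k)) -` A k \<inter> space (path_filtration (t k))"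
    by (auto simp: space_path_filtration)
  also have "\<dots> \<in> sets (path_filtration (t k))"
    using measurable_coordinate[OF tk(1) order_refl] A[of k] k sets_m by (intro measurable_sets) auto
  finally have B': "B' \<in> sets (path_filtration (t k))" using B unfolding B'_def by blast
  then have B'2: "B' \<in> sets (path_filtration (t (n - j)))"
    using path_filtration_mono[of "t k" "t (Suc k)"] s k by (auto simp: s_def)
  have B'P: "B' \<in> sets P" by (rule path_filtration_sets_P[OF tk(2) B'])
  have Bp: "B \<subseteq> paths" using sets.sets_into_space[OF B] by (simp add: space_path_filtration)
  have "{k..n} = insert k {Suc k..n}" using k by auto
  then have "B \<inter> {\<omega>\<in>paths. \<forall>i\<in>{n - Suc j..n}. \<omega> (t i) \<in> A i}
      = B' \<inter> {\<omega>\<in>paths. \<forall>i\<in>{n - j..n}. \<omega> (t i) \<in> A i}"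
    unfolding k_def[symmetric] k(1) B'_def by auto
  then have "measure P (B \<inter> {\<omega>\<in>paths. \<forall>i\<in>{n - Suc j..n}. \<omega> (t i) \<in> A i})
      = (LINT \<omega>:B'|P. g (\<omega> (t (Suc k))))"
    using Suc.IH[OF j B'2] k by (simp add: g_def)
  also have "\<dots> = (LINT \<omega>:B'|P. g' (\<omega> (t k + s)))"
    unfolding set_lebesgue_integral_def s_def
    using AE_coordinate[OF tk(3,4) gg'] B'P
      measurable_compose[OF measurable_coordinate_P[OF tk(3,4)] gm]
      bounded_borel_coordinate_measurable[OF tk(3,4) g']
    by (intro integral_cong_AE) auto
  also have "\<dots> = (LINT \<omega>:B'|P. T s g' (\<omega> (t k)))"
    by (rule markov_property[OF tk(1) s _ g' B']) (use tk in \<open>simp add: s_def\<close>)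
  also have "\<dots> = (LINT \<omega>:B'|P. T s g (\<omega> (t k)))"
    unfolding set_lebesgue_integral_def
    using AE_coordinate[OF tk(1,2) TT] B'P
      measurable_compose[OF measurable_coordinate_P[OF tk(1,2)] Tgm(1)]
      measurable_compose[OF measurable_coordinate_P[OF tk(1,2)] Tgm(2)]
    by (intro integral_cong_AE) auto
  also have "\<dots> = (LINT \<omega>:B|P. nested T t A n (Suc j) (\<omega> (t k)))"
    unfolding set_lebesgue_integral_def eq using Bp
    by (intro Bochner_Integration.integral_cong) (auto simp: B'_def indicator_def)
  finally show ?case by (simp add: k_def)
qed

lemma prob_path_eq:
  "measure P {\<omega>\<in>paths. \<forall>i\<le>n. \<omega> (t i) \<in> A i} = (\<integral>x. nested T t A n n x \<partial>m)"
proof -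
  have "paths \<in> sets (path_filtration (t (n - n)) :: (real \<Rightarrow> 'a) measure)"
    by (metis sets.top space_path_filtration)
  from prob_cylinder[OF order_refl this]
  have "measure P (paths \<inter> {\<omega>\<in>paths. \<forall>i\<in>{n - n..n}. \<omega> (t i) \<in> A i})
      = (LINT \<omega>:space P|P. nested T t A n n (\<omega> 0))" by (simp add: t0 space_P)
  also have "\<dots> = (\<integral>\<omega>. nested T t A n n (\<omega> 0) \<partial>P)"
    by (simp add: set_lebesgue_integral_def cong: Bochner_Integration.integral_cong)
  also have "\<dots> = (\<integral>x. nested T t A n n x \<partial>m)"
    using L2D(1)[OF nested_properties(1)[OF order_refl]] measurable_m_iff
    by (intro integral_coordinate_0) blast
  also have "paths \<inter> {\<omega>\<in>paths. \<forall>i\<in>{n - n..n}. \<omega> (t i) \<in> A i} = {\<omega>\<in>paths. \<forall>i\<le>n. \<omega> (t i) \<in> A i}"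
    by auto
  finally show ?thesis .
qed

text \<open>The full nested function vanishes off \<open>A 0\<close>, so Cauchy-Schwarz against that
  indicator turns the norm bound into the integral bound, with the factor
  \<open>sqrt (m(A_0))\<close>.\<close>

lemma nested_integral_le:
  "(\<integral>x. nested T t A n n x \<partial>m) \<le> sqrt (measure m (A 0)) * sqrt (measure m (A n)) *
     exp_neg_half (\<Sum>i<n. (intrinsic_dist m E D (A i) (A (Suc i)))\<^sup>2 / ereal (t (Suc i) - t i))"
    (is "_ \<le> _ * _ * exp_neg_half ?S")
proof -
  let ?g = "nested T t A n n"
  have gL: "?g \<in> L2 m" by (rule nested_properties(1)) simp
  have iL: "(indicator (A 0) :: 'a \<Rightarrow> real) \<in> L2 m"
    using A[of 0] sets_m by (intro bounded_borel_L2 indicator_bounded_borel) simp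
  have "(\<integral>x. ?g x \<partial>m) = (\<integral>x. indicator (A 0) x * ?g x \<partial>m)"
    using nested_properties(3)[of n] by (intro Bochner_Integration.integral_cong) (auto simp: indicator_def)
  also have "\<dots> \<le> sqrt ((\<integral>x. (indicator (A 0) x)\<^sup>2 \<partial>m) * (\<integral>x. (?g x)\<^sup>2 \<partial>m))"
    by (rule real_le_rsqrt[OF L2_Cauchy_Schwarz[OF iL gL]])
  also have "(\<integral>x. (indicator (A 0) x :: real)\<^sup>2 \<partial>m) = (\<integral>x. indicator (A 0) x \<partial>m)"
    by (intro Bochner_Integration.integral_cong) (auto simp: indicator_def)
  also have "(\<integral>x. indicator (A 0) x \<partial>m) = measure m (A 0)" using A[of 0] by (simp add: space_m)
  also have "sqrt (measure m (A 0) * (\<integral>x. (?g x)\<^sup>2 \<partial>m))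
     \<le> sqrt (measure m (A 0) * (measure m (A n) * (exp_neg_half ?S)\<^sup>2))"
    using nested_norm_le[OF order_refl]
    by (intro real_sqrt_le_mono mult_left_mono) (auto simp: lessThan_atLeast0)
  also have "\<dots> = sqrt (measure m (A 0)) * sqrt (measure m (A n)) * exp_neg_half ?S"
    by (simp add: real_sqrt_mult exp_neg_half_nonneg)
  finally show ?thesis .
qed

end

end

theorem theorem3p1:
  fixes m :: "'a::polish_space measure"
    and E :: "('a \<Rightarrow> real) \<Rightarrow> ('a \<Rightarrow> real) \<Rightarrow> real"
    and D :: "('a \<Rightarrow> real) set"
    and T :: "real \<Rightarrow> ('a \<Rightarrow> real) \<Rightarrow> ('a \<Rightarrow> real)"
    and P :: "(real \<Rightarrow> 'a) measure"
    and n :: nat and t :: "nat \<Rightarrow> real" and A :: "nat \<Rightarrow> 'a set"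
  assumes "prob_space m" and "sets m = sets borel"
    and "dirichlet_form m E D" and "local_form m E D"
    and "associated_semigroup m E D T" and "conservative m T"
    and "associated_process m T P"
    and "t 0 = 0" and "t n = 1" and "\<And>i. i < n \<Longrightarrow> t i < t (Suc i)"
    and "\<And>i. i \<le> n \<Longrightarrow> A i \<in> sets m"
  shows "measure P {\<omega>\<in>paths. \<forall>i\<le>n. \<omega> (t i) \<in> A i} = (\<integral>x. nested T t A n n x \<partial>m)
    \<and> (\<integral>x. nested T t A n n x \<partial>m)
        \<le> sqrt (measure m (A 0)) * sqrt (measure m (A n)) *
          exp_neg_half (\<Sum>i<n. (intrinsic_dist m E D (A i) (A (Suc i)))\<^sup>2
                                 / ereal (t (Suc i) - t i))"
proof -
  interpret prob_space m by fact
  interpret dirichlet_process m T E D P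
    by unfold_locales (use assms in \<open>auto simp: associated_semigroup_def\<close>)
  show ?thesis
    using prob_path_eq[of t n A] nested_integral_le[of t n A] assms(8-) by simp
qed

end
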